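(* Let $m=3$. For any integers $i_1<i_2<i_3$ one has in $\overline{\mathbb G}_3$ $$\sigma_1(\mathrm P_{i_1,i_2,i_3})=d(\mathsf t_1(v_{i_1}),\mathsf t_1(v_{i_2}),\mathsf t_1(v_{i_3})),\qquad \sigma_2(\mathrm P_{i_1,i_2,i_3})=d(\mathsf t_2(v_{i_1}),\mathsf t_2(v_{i_2}),\mathsf t_2(v_{i_3})),$$ where for $k\in\mathbb Z$ $$\mathsf t_1(v_k)=\begin{cases}v_k&k\equiv0\bmod3,\\ v_{k+1}&k\equiv1\bmod3,\\ d(v_{k-1},v_{k+1},v_{k+2})\,v_k-v_{k-1}&k\equiv2\bmod3,\end{cases}\qquad \mathsf t_2(v_k)=\begin{cases}d(v_{k-1},v_{k+1},v_{k+2})\,v_k-v_{k-1}&k\equiv0\bmod3,\\ v_k&k\equiv1\bmod3,\\ v_{k+1}&k\equiv2\bmod3.\end{cases}$$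
   Context: Set $m=3$. $\mathcal C(m)$ is the set of strictly increasing $m$-tuples of integers and $\mathcal F(m)=\{(i,i+1,\dots,i+m-1): i\in\mathbb Z\}$. For $\mathbf i\in\mathcal C(m)$ let $\mathrm P_{\mathbf i}$ be an indeterminate; $\mathrm P$ of a permuted tuple is $\mathrm P_{\mathbf i}$ times the sign of the permutation, and $\mathrm P=0$ if an index repeats. $\mathbb G_m$ is the quotient of $\mathbb C[\mathrm P_{\mathbf i},\mathrm P_{\mathbf j}^{-1}:\mathbf i\in\mathcal C(m),\mathbf j\in\mathcal F(m)]$ by the ideal generated by the Plücker relations $\sum_{t=1}^{m+1}(-1)^t\mathrm P_{i_1,\dots,i_{m-1},j_t}\mathrm P_{j_1,\dots,\widehat{j_t},\dots,j_{m+1}}$ for $(i_1,\dots,i_{m-1})\in\mathcal C(m-1)$, $(j_1,\dots,j_{m+1})\in\mathcal C(m+1)$. $\overline{\mathbb G}_m$ is the quotient of $\mathbb G_m$ by the ideal generated by all $\mathrm P_{\mathbf j}-1$, $\mathbf j\in\mathcal F(m)$. $\mathrm{sh}_t$ is the automorphism $\mathrm P_{\mathbf i}\mapsto\mathrm P_{\mathbf i+t}$ (adding $t$ to all entries). $\overline{\mathbb G}_m^+$ is the subalgebra of $\overline{\mathbb G}_m$ generated by the $\mathrm P_{\mathbf i}$ with all entries $\ge1$. The symbol $d(v_{i},v_{j},v_{k})$ stands for (the class in $\overline{\mathbb G}_3$ of) $\det(v_i,v_j,v_k)$, i.e. $d(v_i,v_j,v_k)=\mathrm P_{i,j,k}$,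 and $d$ is extended trilinearly (over $\overline{\mathbb G}_3$) to formal $\overline{\mathbb G}_3$-linear combinations of the symbols $v_k$, $k\in\mathbb Z$. The maps $\sigma_i$: Let $m\mid N$ and $V=\mathbb C^m$. $\widetilde{\mathrm{Gr}}(m,N)$ is the affine cone over the Grassmannian with Plücker coordinates $\Delta_{\mathbf i}$; $\widetilde{\mathrm{Gr}}^\circ(m,N)$ is the open subset where all cyclically consecutive Plücker coordinates are nonzero, identified with $\mathrm{SL}(V)\backslash(V^N)^\circ$, where $(V^N)^\circ$ is the set of $N$-tuples whose cyclically consecutive $m$ vectors are linearly independent, with $\Delta_{\mathbf i}(v)=\det(v_{i_1},\dots,v_{i_m})$. $\mathbb C[\widetilde{\mathrm{Gr}}^\diamondsuit(m,N)]\subset\mathbb C[\widetilde{\mathrm{Gr}}^\circ(m,N)]$ is the localization of $\mathbb C[\widetilde{\mathrm{Gr}}(m,N)]$ at the $\Delta_{\mathbf j}$, $\mathbf j\in\mathcal F(m)$, $\mathbf j\subset[1,N]$, and $\pi:\mathbb C[\widetilde{\mathrm{Gr}}^\diamondsuit(m,N)]\to\overline{\mathbb G}_m$ is $\Delta_{\mathbf i}\mapsto\mathrm P_{\mathbf i}$. The map $\kappa$ on $\mathrm{SL}(V)\backslash(V^N)^\circ$ replaces, for every $0\le t<N/m$, the pair $(v_{tm+1},v_{tm+2})$ by $(v_{tm+2},w_{tm+1})$, where $w_{tm+1}=\frac{\det(v_{tm+1},v_{tm+3},\dots,v_{(t+1)m+1})}{\det(v_{tm+2},v_{tm+3},\dots,v_{(t+1)m+1})}v_{tm+2}-v_{tm+1}$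 (with $v_{N+1}=v_1$); $\tilde\sigma_1$ is the pullback by $\kappa$. For $x\in\overline{\mathbb G}_m^+$ choose $N$ sufficiently large with $m\mid N$ and $x_\circ$ with $\pi(x_\circ)=x$, and put $\sigma_1(x)=\pi(\tilde\sigma_1(x_\circ))$ (independent of choices for large $N$). For $2\le k\le m-1$ put $\sigma_k=\mathrm{sh}_{k-m-1}\circ\sigma_1\circ\mathrm{sh}_{m+1-k}$ on $\overline{\mathbb G}_m^+$. Each $\sigma_i$ commutes with $\mathrm{sh}_m$, and is extended to $\overline{\mathbb G}_m$ by $\sigma_i(x)=\mathrm{sh}_{-mt}\circ\sigma_i\circ\mathrm{sh}_{mt}(x)$ for $t\gg0$. *)

theory Defs
  imports
    "HOL-Library.Poly_Mapping"
    "HOL-Library.FuncSet"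
    "HOL-Combinatorics.Permutations"
    "HOL-Algebra.QuotRing"
    "HOL-Algebra.Generated_Rings"
    "Jordan_Normal_Form.Determinant"
begin

section \<open>Index tuples\<close>

definition tuples :: "nat \<Rightarrow> int list set" where
  "tuples m = {is. length is = m \<and> sorted_wrt (<) is}"

definition frozen :: "nat \<Rightarrow> int list set" where
  "frozen m = {[i..i + int m - 1] | i. True}"

definition tuples_upto :: "nat \<Rightarrow> nat \<Rightarrow> int list set" where
  "tuples_upto m N = {is \<in> tuples m. set is \<subseteq> {1..int N}}"


section \<open>Laurent polynomials\<close>

text \<open>
  A monomial maps each indeterminate, named by its index tuple, to its integer exponent;
  a Laurent polynomial maps each monomial to its coefficient.  Multiplication on this type is
  the convolution product of Poly_Mapping.
\<close>

type_synonym mono = "int list \<Rightarrow>\<^sub>0 int"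
type_synonym laurent = "mono \<Rightarrow>\<^sub>0 complex"

text \<open>
  The Laurent polynomials in the indeterminates named by \<open>I\<close>, of which only those in \<open>S\<close> are
  inverted.
\<close>

definition laurent_in :: "int list set \<Rightarrow> int list set \<Rightarrow> laurent set" where
  "laurent_in I S =
     {p. \<forall>\<mu>\<in>Poly_Mapping.keys p. \<forall>i\<in>Poly_Mapping.keys \<mu>.
           i \<in> I \<and> (Poly_Mapping.lookup \<mu> i < 0 \<longrightarrow> i \<in> S)}"

definition const :: "complex \<Rightarrow> laurent" where
  "const c = Poly_Mapping.single 0 c"

definition indet :: "int list \<Rightarrow> laurent" where
  "indet is = Poly_Mapping.single (Poly_Mapping.single is 1) 1"

text \<open>
  The indeterminate of an arbitrary tuple: alternating in the indices, and zero if an index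
  repeats.
\<close>

definition alt :: "int list \<Rightarrow> laurent" where
  "alt is =
     (if distinct is
      then of_int (sign (THE p. p permutes {..<length is} \<and> permute_list p (sort is) = is))
             * indet (sort is)
      else 0)"


section \<open>The algebras\<close>

definition laurent_ring :: "nat \<Rightarrow> laurent ring" where
  "laurent_ring m =
     \<lparr>carrier = laurent_in (tuples m) (frozen m), monoid.mult = (*), one = 1, zero = 0, add = (+)\<rparr>"

text \<open>For \<open>t = 1, \<dots>, m + 1\<close> the list element \<open>js ! (t - 1)\<close> is \<open>j\<^sub>t\<close>.\<close>

definition pluecker_rel :: "nat \<Rightarrow> int list \<Rightarrow> int list \<Rightarrow> laurent" where
  "pluecker_rel m is js =
     (\<Sum>t = 1..m + 1. (-1) ^ t * alt (is @ [js ! (t - 1)]) * alt (take (t - 1) js @ drop t js))"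

definition pluecker_ideal :: "nat \<Rightarrow> laurent set" where
  "pluecker_ideal m =
     genideal (laurent_ring m)
       {pluecker_rel m is js | is js. is \<in> tuples (m - 1) \<and> js \<in> tuples (m + 1)}"

definition GG :: "nat \<Rightarrow> laurent set ring" where
  "GG m = laurent_ring m Quot pluecker_ideal m"

definition GG_class :: "nat \<Rightarrow> laurent \<Rightarrow> laurent set" where
  "GG_class m p = pluecker_ideal m +>\<^bsub>laurent_ring m\<^esub> p"

definition frozen_ideal :: "nat \<Rightarrow> laurent set set" where
  "frozen_ideal m =
     genideal (GG m) {GG_class m (indet j) \<ominus>\<^bsub>GG m\<^esub> \<one>\<^bsub>GG m\<^esub> | j. j \<in> frozen m}"

definition GGbar :: "nat \<Rightarrow> laurent set set ring" where
  "GGbar m = GG m Quot frozen_ideal m"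

definition GGbar_class :: "nat \<Rightarrow> laurent \<Rightarrow> laurent set set" where
  "GGbar_class m p = frozen_ideal m +>\<^bsub>GG m\<^esub> GG_class m p"

definition Plu :: "nat \<Rightarrow> int list \<Rightarrow> laurent set set" where
  "Plu m is = GGbar_class m (alt is)"

text \<open>A subalgebra is a subring containing the scalars.\<close>

definition GGbar_plus :: "nat \<Rightarrow> laurent set set set" where
  "GGbar_plus m =
     generate_ring (GGbar m)
       (range (\<lambda>c. GGbar_class m (const c))
        \<union> {Plu m is | is. is \<in> tuples m \<and> (\<forall>i\<in>set is. 1 \<le> i)})"


section \<open>Shifts\<close>

definition shift_mono :: "int \<Rightarrow> mono \<Rightarrow> mono" where
  "shift_mono t \<mu> =
     (\<Sum>i\<in>Poly_Mapping.keys \<mu>. Poly_Mapping.single (map (\<lambda>k. k + t) i) (Poly_Mapping.lookup \<mu> i))"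

definition shift_laurent :: "int \<Rightarrow> laurent \<Rightarrow> laurent" where
  "shift_laurent t p =
     (\<Sum>\<mu>\<in>Poly_Mapping.keys p. Poly_Mapping.single (shift_mono t \<mu>) (Poly_Mapping.lookup p \<mu>))"

text \<open>
  An element of the iterated quotient is a coset of cosets.  The shift of Laurent polynomials
  is an automorphism preserving the Pluecker relations and the frozen indeterminates, so the
  automorphism it induces on the quotient sends such an element to its image.
\<close>

definition sh :: "int \<Rightarrow> laurent set set \<Rightarrow> laurent set set" where
  "sh t x = (\<lambda>X. shift_laurent t ` X) ` x"


section \<open>Functions on the open part of the cone over the Grassmannian\<close>

text \<open>Here \<open>V = \<complex>\<^sup>m\<close>; \<open>pdet\<close> also accepts lists of indices that are not increasing.\<close>

definition pdet :: "nat \<Rightarrow> (int \<Rightarrow> complex vec) \<Rightarrow> int list \<Rightarrow> complex" where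
  "pdet m v is = det (mat_of_cols m (map v is))"

text \<open>The representative of \<open>k\<close> modulo \<open>N\<close> in \<open>{1..N}\<close>.\<close>

definition cyc :: "nat \<Rightarrow> int \<Rightarrow> int" where
  "cyc N k = (k - 1) mod int N + 1"

text \<open>
  The \<open>N\<close>-tuples of vectors any \<open>m\<close> cyclically consecutive members of which are linearly
  independent, i.e. the columns admit no nontrivial linear relation \<open>c\<close>.
\<close>

definition config :: "nat \<Rightarrow> nat \<Rightarrow> (int \<Rightarrow> complex vec) set" where
  "config m N =
     {v \<in> {1..int N} \<rightarrow>\<^sub>E carrier_vec m.
        \<forall>s\<in>{1..int N}. \<forall>c\<in>carrier_vec m.
          mat_of_cols m (map (\<lambda>k. v (cyc N k)) [s..s + int m - 1]) *\<^sub>v c = 0\<^sub>v m \<longrightarrow> c = 0\<^sub>v m}"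

definition eval_pdet :: "nat \<Rightarrow> laurent \<Rightarrow> (int \<Rightarrow> complex vec) \<Rightarrow> complex" where
  "eval_pdet m p v =
     (\<Sum>\<mu>\<in>Poly_Mapping.keys p. Poly_Mapping.lookup p \<mu> *
        (\<Prod>i\<in>Poly_Mapping.keys \<mu>. pdet m v i powi Poly_Mapping.lookup \<mu> i))"

text \<open>
  The open part of the cone is the orbit space of \<open>config m N\<close> under \<open>SL(V)\<close>, with the
  Pluecker coordinates given by \<open>pdet\<close>.  Regular functions on it are represented by their
  (\<open>SL(V)\<close>-invariant) pullbacks to \<open>config m N\<close>, undefined elsewhere.
\<close>

definition as_function :: "nat \<Rightarrow> nat \<Rightarrow> laurent \<Rightarrow> (int \<Rightarrow> complex vec) \<Rightarrow> complex" where
  "as_function m N p = restrict (eval_pdet m p) (config m N)"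

text \<open>
  The localization of the homogeneous coordinate ring at the Pluecker coordinates of the
  intervals contained in \<open>{1..N}\<close>; the intervals that wrap around are not inverted.
\<close>

definition local_laurent :: "nat \<Rightarrow> nat \<Rightarrow> laurent set" where
  "local_laurent m N = laurent_in (tuples_upto m N) (frozen m \<inter> tuples_upto m N)"

definition local_coord_ring :: "nat \<Rightarrow> nat \<Rightarrow> ((int \<Rightarrow> complex vec) \<Rightarrow> complex) set" where
  "local_coord_ring m N = as_function m N ` local_laurent m N"

text \<open>The algebra homomorphism sending each Pluecker coordinate to the element \<open>Plu\<close> with the same index.\<close>

definition proj :: "nat \<Rightarrow> nat \<Rightarrow> ((int \<Rightarrow> complex vec) \<Rightarrow> complex) \<Rightarrow> laurent set set" where
  "proj m N f = (THE y. \<exists>p\<in>local_laurent m N. f = as_function m N p \<and> y = GGbar_class m p)"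


section \<open>The maps \<open>\<sigma>\<close>\<close>

definition kappa_vec :: "nat \<Rightarrow> nat \<Rightarrow> (int \<Rightarrow> complex vec) \<Rightarrow> int \<Rightarrow> complex vec" where
  "kappa_vec m N v a =
     (let v' = (\<lambda>k. v (cyc N k))
      in (pdet m v' (a # [a + 2..a + int m]) / pdet m v' ((a + 1) # [a + 2..a + int m]))
           \<cdot>\<^sub>v v (a + 1) - v a)"

definition kappa :: "nat \<Rightarrow> nat \<Rightarrow> (int \<Rightarrow> complex vec) \<Rightarrow> int \<Rightarrow> complex vec" where
  "kappa m N v =
     restrict (\<lambda>k. if k mod int m = 1 mod int m then v (k + 1)
                   else if k mod int m = 2 mod int m then kappa_vec m N v (k - 1)
                   else v k) {1..int N}"

definition sigma_tilde ::
    "nat \<Rightarrow> nat \<Rightarrow> ((int \<Rightarrow> complex vec) \<Rightarrow> complex) \<Rightarrow> (int \<Rightarrow> complex vec) \<Rightarrow> complex" where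
  "sigma_tilde m N f = restrict (\<lambda>v. f (kappa m N v)) (config m N)"

text \<open>
  The admissible lifts \<open>x\<^sub>\<circ>\<close> of \<open>x\<close>.  As \<open>kappa\<close> wraps around, \<open>sigma_tilde\<close> can introduce a
  denominator that is not inverted in \<open>local_coord_ring\<close>; \<open>proj\<close> is applicable to the result
  only if this does not happen.
\<close>

definition lifts :: "nat \<Rightarrow> nat \<Rightarrow> laurent set set \<Rightarrow> ((int \<Rightarrow> complex vec) \<Rightarrow> complex) set" where
  "lifts m N x =
     {f \<in> local_coord_ring m N. proj m N f = x \<and> sigma_tilde m N f \<in> local_coord_ring m N}"

text \<open>The common value, for all large \<open>N\<close> and all lifts, on \<open>GGbar_plus m\<close>.\<close>

definition sigma1_plus :: "nat \<Rightarrow> laurent set set \<Rightarrow> laurent set set" where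
  "sigma1_plus m x =
     (THE y. \<exists>N0. \<forall>N\<ge>N0. m dvd N \<longrightarrow>
        lifts m N x \<noteq> {} \<and> (\<forall>f\<in>lifts m N x. proj m N (sigma_tilde m N f) = y))"

definition sigma_plus :: "nat \<Rightarrow> nat \<Rightarrow> laurent set set \<Rightarrow> laurent set set" where
  "sigma_plus m k x =
     (if k = 1 then sigma1_plus m x
      else sh (int k - int m - 1) (sigma1_plus m (sh (int m + 1 - int k) x)))"

definition sigma :: "nat \<Rightarrow> nat \<Rightarrow> laurent set set \<Rightarrow> laurent set set" where
  "sigma m k x =
     (THE y. \<exists>T. \<forall>t\<ge>T. sh (int m * t) x \<in> GGbar_plus m \<and>
        y = sh (- int m * t) (sigma_plus m k (sh (int m * t) x)))"


section \<open>Formal linear combinations of the symbols \<open>v\<^sub>k\<close>, for \<open>m = 3\<close>\<close>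

text \<open>A combination is given by its coefficient function, which is finitely supported.\<close>

type_synonym comb = "int \<Rightarrow> laurent set set"

definition vsym :: "int \<Rightarrow> comb" where
  "vsym k = (\<lambda>j. if j = k then \<one>\<^bsub>GGbar 3\<^esub> else \<zero>\<^bsub>GGbar 3\<^esub>)"

definition comb_scale :: "laurent set set \<Rightarrow> comb \<Rightarrow> comb" where
  "comb_scale c f = (\<lambda>j. c \<otimes>\<^bsub>GGbar 3\<^esub> f j)"

definition comb_diff :: "comb \<Rightarrow> comb \<Rightarrow> comb" where
  "comb_diff f g = (\<lambda>j. f j \<ominus>\<^bsub>GGbar 3\<^esub> g j)"

definition comb_supp :: "comb \<Rightarrow> int set" where
  "comb_supp f = {j. f j \<noteq> \<zero>\<^bsub>GGbar 3\<^esub>}"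

definition triple_det :: "comb \<Rightarrow> comb \<Rightarrow> comb \<Rightarrow> laurent set set" where
  "triple_det f g h =
     finsum (GGbar 3)
       (\<lambda>(i, j, k). f i \<otimes>\<^bsub>GGbar 3\<^esub> g j \<otimes>\<^bsub>GGbar 3\<^esub> h k \<otimes>\<^bsub>GGbar 3\<^esub> Plu 3 [i, j, k])
       (comb_supp f \<times> comb_supp g \<times> comb_supp h)"

definition t1 :: "int \<Rightarrow> comb" where
  "t1 k =
     (if k mod 3 = 0 then vsym k
      else if k mod 3 = 1 then vsym (k + 1)
      else comb_diff (comb_scale (triple_det (vsym (k - 1)) (vsym (k + 1)) (vsym (k + 2))) (vsym k)) (vsym (k - 1)))"

definition t2 :: "int \<Rightarrow> comb" where
  "t2 k =
     (if k mod 3 = 0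
      then comb_diff (comb_scale (triple_det (vsym (k - 1)) (vsym (k + 1)) (vsym (k + 2))) (vsym k)) (vsym (k - 1))
      else if k mod 3 = 1 then vsym k
      else vsym (k + 1))"

end

theory Submission
  imports Defs
begin

text \<open>
  A Laurent polynomial vanishes in the quotient as soon as it vanishes at all configurations whose
  non-wrapping consecutive minors are 1.  Indeed such a configuration satisfies a three-term
  recursion with free coefficients, the class of every Pluecker coordinate is a polynomial in the
  classes of these coefficients by the same recursion, and a complex polynomial that vanishes on a
  nonempty Zariski open set is zero.  Hence identities in the quotient can be checked on vectors,
  where \<open>\<kappa>\<close> acts by the formulas for \<open>t1\<close>; \<open>\<kappa>\<close> preserves the normalization of the
  minors, and every normalized configuration extends to a sequence indexed by the integers with all
  consecutive minors 1, so the value of \<open>\<sigma>\<^sub>1\<close> does not depend on the chosen lift.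
\<close>


section \<open>Laurent polynomials\<close>

text \<open>The obstacle is that \<open>proj\<close> and \<open>sigma1_plus\<close> are descriptions
  over all representatives and all lifts. Laurent polynomials representing two lifts of one class
  differ by something like a multiple of \<open>indet j - 1\<close>, which need not vanish at a
  general configuration; it does vanish where the non-wrapping minors are 1, so different lifts can
  be compared only there. By contrast, that \<open>sigma_tilde\<close> of a lift lies in
  \<open>local_coord_ring\<close> is an equality of functions on the whole of \<open>config\<close>.
  Therefore the denominators of \<open>kappa\<close> are carried along as frozen inverses and turn
  into 1 only when classes are taken. The Zariski open set is forced by \<open>config\<close>, which
  also asks the two minors that wrap around to be nonzero, although no relation in the quotient
  restricts them. The two maps are treated together: conjugating by a shift moves the residue at
  which the pattern of cases starts, and this residue is a parameter of the formulas.\<close>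

definition inv_indet :: "int list \<Rightarrow> laurent" where
  "inv_indet is = Poly_Mapping.single (Poly_Mapping.single is (- 1)) 1"

definition mono_in :: "int list set \<Rightarrow> int list set \<Rightarrow> mono set" where
  "mono_in I S = {\<mu>. \<forall>i\<in>Poly_Mapping.keys \<mu>. i \<in> I \<and> (Poly_Mapping.lookup \<mu> i < 0 \<longrightarrow> i \<in> S)}"

lemma mono_in_iff:
  "\<mu> \<in> mono_in I S \<longleftrightarrow> (\<forall>i. Poly_Mapping.lookup \<mu> i \<noteq> 0 \<longrightarrow> i \<in> I \<and> (Poly_Mapping.lookup \<mu> i < 0 \<longrightarrow> i \<in> S))"
  by (auto simp: mono_in_def in_keys_iff)

lemma laurent_in_iff: "p \<in> laurent_in I S \<longleftrightarrow> Poly_Mapping.keys p \<subseteq> mono_in I S"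
  by (auto simp: laurent_in_def mono_in_def)

lemma mono_in_zero: "0 \<in> mono_in I S"
  by (simp add: mono_in_def)

lemma mono_in_add:
  assumes "\<mu> \<in> mono_in I S" "\<nu> \<in> mono_in I S" shows "\<mu> + \<nu> \<in> mono_in I S"
proof -
  have "i \<in> I \<and> (Poly_Mapping.lookup (\<mu> + \<nu>) i < 0 \<longrightarrow> i \<in> S)"
    if "Poly_Mapping.lookup (\<mu> + \<nu>) i \<noteq> 0" for i
    using assms[unfolded mono_in_iff, rule_format, of i] that
    by (cases "Poly_Mapping.lookup \<mu> i = 0"; cases "Poly_Mapping.lookup \<nu> i = 0")
      (simp_all add: lookup_add, linarith)
  then show ?thesis by (simp add: mono_in_iff)
qed

lemma laurent_in_zero: "0 \<in> laurent_in I S"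
  by (simp add: laurent_in_iff)

lemma laurent_in_single: "\<mu> \<in> mono_in I S \<Longrightarrow> Poly_Mapping.single \<mu> c \<in> laurent_in I S"
  by (simp add: laurent_in_iff)

lemma laurent_in_const: "const c \<in> laurent_in I S"
  by (simp add: const_def laurent_in_single mono_in_zero)

lemma laurent_in_indet: "i \<in> I \<Longrightarrow> indet i \<in> laurent_in I S"
  unfolding indet_def by (rule laurent_in_single) (simp add: mono_in_def)

lemma laurent_in_inv_indet: "i \<in> I \<Longrightarrow> i \<in> S \<Longrightarrow> inv_indet i \<in> laurent_in I S"
  unfolding inv_indet_def by (rule laurent_in_single) (simp add: mono_in_def)

lemma laurent_in_add: "p \<in> laurent_in I S \<Longrightarrow> q \<in> laurent_in I S \<Longrightarrow> p + q \<in> laurent_in I S"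
  using Poly_Mapping.keys_add[of p q] by (auto simp: laurent_in_iff)

lemma laurent_in_mult:
  assumes "p \<in> laurent_in I S" "q \<in> laurent_in I S" shows "p * q \<in> laurent_in I S"
proof -
  have "Poly_Mapping.keys (p * q) \<subseteq> {a + b |a b. a \<in> Poly_Mapping.keys p \<and> b \<in> Poly_Mapping.keys q}"
    by (rule keys_mult)
  also have "\<dots> \<subseteq> mono_in I S"
    using assms by (auto simp: laurent_in_iff intro: mono_in_add)
  finally show ?thesis by (simp add: laurent_in_iff)
qed

lemma laurent_in_uminus: "p \<in> laurent_in I S \<Longrightarrow> - p \<in> laurent_in I S"
  by (simp add: laurent_in_iff)

lemma laurent_in_diff: "p \<in> laurent_in I S \<Longrightarrow> q \<in> laurent_in I S \<Longrightarrow> p - q \<in> laurent_in I S"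
  using laurent_in_add[OF _ laurent_in_uminus] by fastforce

lemma const_0: "const 0 = 0" and const_1: "const 1 = 1"
  by (simp_all add: const_def)

lemma const_add: "const (c + d) = const c + const d"
  by (simp add: const_def single_add)

lemma const_mult: "const (c * d) = const c * const d"
  by (simp add: const_def mult_single)

lemma const_uminus: "const (- c) = - const c"
  by (simp add: const_def single_uminus)

lemma laurent_in_one: "1 \<in> laurent_in I S"
  using laurent_in_const[of 1] by (simp add: const_1)

lemma laurent_in_of_int: "of_int n \<in> laurent_in I S"
  using laurent_in_const[of "of_int n" I S] by (simp add: const_def)

lemma laurent_in_sum: "(\<And>x. x \<in> A \<Longrightarrow> f x \<in> laurent_in I S) \<Longrightarrow> sum f A \<in> laurent_in I S"
  by (induction A rule: infinite_finite_induct) (auto intro: laurent_in_zero laurent_in_add)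

lemma laurent_in_power: "p \<in> laurent_in I S \<Longrightarrow> p ^ n \<in> laurent_in I S"
  by (induction n) (auto intro: laurent_in_one laurent_in_mult)

lemma laurent_in_mono: "I \<subseteq> I' \<Longrightarrow> S \<subseteq> S' \<Longrightarrow> laurent_in I S \<subseteq> laurent_in I' S'"
  by (auto simp: laurent_in_def)

lemmas laurent_in_intros = laurent_in_zero laurent_in_one laurent_in_const laurent_in_of_int
  laurent_in_add laurent_in_mult laurent_in_uminus laurent_in_diff laurent_in_sum laurent_in_power

lemma indet_inv_indet: "indet i * inv_indet i = 1"
  by (simp add: indet_def inv_indet_def mult_single flip: single_add)

lemma poly_mapping_sum_singles:
  "(\<Sum>\<mu>\<in>Poly_Mapping.keys p. Poly_Mapping.single \<mu> (Poly_Mapping.lookup p \<mu>)) = p"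
  by (rule poly_mapping_eqI)
    (simp add: lookup_sum lookup_single when_def in_keys_iff)

text \<open>Arguments about ring homomorphisms on a localization reduce to generators. A polynomial
  is a sum of terms, a term is a constant times a product over its keys, and each factor is a power
  of \<open>indet\<close> or of \<open>inv_indet\<close> according to the sign of its
  exponent.\<close>

lemma laurent_in_induct [consumes 1, case_names const indet inv add mult]:
  assumes p: "p \<in> laurent_in I S"
    and const: "\<And>c. Q (const c)"
    and indet: "\<And>i. i \<in> I \<Longrightarrow> Q (indet i)"
    and inv: "\<And>i. i \<in> I \<Longrightarrow> i \<in> S \<Longrightarrow> Q (inv_indet i)"
    and add: "\<And>p q. p \<in> laurent_in I S \<Longrightarrow> q \<in> laurent_in I S \<Longrightarrow> Q p \<Longrightarrow> Q q \<Longrightarrow> Q (p + q)"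
    and mult: "\<And>p q. p \<in> laurent_in I S \<Longrightarrow> q \<in> laurent_in I S \<Longrightarrow> Q p \<Longrightarrow> Q q \<Longrightarrow> Q (p * q)"
  shows "Q p"
proof -
  have power: "Q (p ^ n)" if "p \<in> laurent_in I S" "Q p" for p n
  proof (induction n)
    case 0
    show ?case using const[of 1] by (simp add: const_1)
  next
    case (Suc n)
    then show ?case using that by (simp add: mult laurent_in_power)
  qed
  have single_power: "Poly_Mapping.single (Poly_Mapping.single i k) 1 ^ n =
      (Poly_Mapping.single (Poly_Mapping.single i (int n * k)) 1 :: laurent)" for i k n
    by (induction n) (simp_all add: mult_single flip: single_add, simp add: algebra_simps)
  have gen: "Q (Poly_Mapping.single (Poly_Mapping.single i k) 1)"
    if "i \<in> I" "k < 0 \<Longrightarrow> i \<in> S" for i k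
  proof (cases "k < 0")
    case True
    have "Poly_Mapping.single (Poly_Mapping.single i k) 1 = inv_indet i ^ nat (- k)"
      using True by (simp add: inv_indet_def single_power)
    then show ?thesis
      using True that by (simp add: power laurent_in_inv_indet inv)
  next
    case False
    have "Poly_Mapping.single (Poly_Mapping.single i k) 1 = indet i ^ nat k"
      using False by (simp add: indet_def single_power)
    then show ?thesis
      using that by (simp add: power laurent_in_indet indet)
  qed
  have mono: "Q (Poly_Mapping.single (\<Sum>i\<in>A. Poly_Mapping.single i (k i)) 1) \<and>
      (\<Sum>i\<in>A. Poly_Mapping.single i (k i)) \<in> mono_in I S"
    if "finite A" "\<And>i. i \<in> A \<Longrightarrow> i \<in> I \<and> (k i < 0 \<longrightarrow> i \<in> S)" for A k
    using that
  proof (induction A)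
    case empty
    show ?case using const[of 1] by (simp add: const_def mono_in_zero)
  next
    case (insert i A)
    let ?s = "\<Sum>i\<in>A. Poly_Mapping.single i (k i)"
    have IH: "Q (Poly_Mapping.single ?s 1)" "?s \<in> mono_in I S"
      using insert.IH insert.prems by simp_all
    have i: "Poly_Mapping.single i (k i) \<in> mono_in I S"
      using insert.prems[of i] by (simp add: mono_in_def)
    have "Poly_Mapping.single (Poly_Mapping.single i (k i) + ?s) 1 =
        Poly_Mapping.single (Poly_Mapping.single i (k i)) 1 * (Poly_Mapping.single ?s 1 :: laurent)"
      by (simp add: mult_single)
    then have "Q (Poly_Mapping.single (Poly_Mapping.single i (k i) + ?s) 1)"
      using IH i insert.prems[of i] by (simp add: mult laurent_in_single gen)
    then show ?case using insert.hyps IH i by (simp add: mono_in_add)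
  qed
  have mono': "Q (Poly_Mapping.single \<mu> c)" if "\<mu> \<in> mono_in I S" for \<mu> c
  proof -
    have "Q (Poly_Mapping.single \<mu> 1)"
      using mono[of "Poly_Mapping.keys \<mu>" "Poly_Mapping.lookup \<mu>"] that
      by (simp add: poly_mapping_sum_singles mono_in_def)
    moreover have "Poly_Mapping.single \<mu> c = const c * Poly_Mapping.single \<mu> 1"
      by (simp add: const_def mult_single)
    ultimately show ?thesis using that by (simp add: mult laurent_in_const laurent_in_single const)
  qed
  have sum: "Q (sum f A) \<and> sum f A \<in> laurent_in I S"
    if "finite A" "\<And>x. x \<in> A \<Longrightarrow> Q (f x) \<and> f x \<in> laurent_in I S" for f and A :: "mono set"
    using that
  proof (induction A)
    case empty
    show ?case using const[of 0] by (simp add: const_0 laurent_in_zero)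
  next
    case (insert x A)
    then show ?case by (simp add: add laurent_in_add)
  qed
  have "Q (\<Sum>\<mu>\<in>Poly_Mapping.keys p. Poly_Mapping.single \<mu> (Poly_Mapping.lookup p \<mu>))"
  proof (rule sum[THEN conjunct1, OF finite_keys])
    fix \<mu> assume "\<mu> \<in> Poly_Mapping.keys p"
    then have "\<mu> \<in> mono_in I S" using p unfolding laurent_in_iff by (rule rev_subsetD)
    then show "Q (Poly_Mapping.single \<mu> (Poly_Mapping.lookup p \<mu>)) \<and>
        Poly_Mapping.single \<mu> (Poly_Mapping.lookup p \<mu>) \<in> laurent_in I S"
      by (intro conjI mono' laurent_in_single)
  qed
  then show ?thesis by (simp only: poly_mapping_sum_singles)
qed

text \<open>
  Both the shifts and the evaluation at vectors extend a map of single terms linearly.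
\<close>

definition linext :: "(mono \<Rightarrow> complex \<Rightarrow> 'a) \<Rightarrow> laurent \<Rightarrow> 'a::comm_ring_1" where
  "linext T p = (\<Sum>\<mu>\<in>Poly_Mapping.keys p. T \<mu> (Poly_Mapping.lookup p \<mu>))"

text \<open>Multiplicativity is restricted to monomials in \<open>M\<close> for the sake of
  evaluation: at a vanishing minor the exponents 1 and -1 give 0 * 0 = 0, whereas the product
  monomial evaluates to 1.\<close>

locale linear_extension =
  fixes T :: "mono \<Rightarrow> complex \<Rightarrow> 'a::comm_ring_1" and M :: "mono set"
  assumes T_zero: "T \<mu> 0 = 0"
    and T_add: "T \<mu> (c + d) = T \<mu> c + T \<mu> d"
    and T_mult: "\<mu> \<in> M \<Longrightarrow> \<nu> \<in> M \<Longrightarrow> T (\<mu> + \<nu>) (c * d) = T \<mu> c * T \<nu> d"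
begin

lemma linext_add: "linext T (p + q) = linext T p + linext T q"
  unfolding linext_def by (rule setsum_keys_plus_distrib) (simp_all add: T_zero T_add)

lemma linext_zero: "linext T 0 = 0"
  by (simp add: linext_def)

lemma linext_sum: "linext T (sum f A) = (\<Sum>x\<in>A. linext T (f x))"
  by (induction A rule: infinite_finite_induct) (simp_all add: linext_add linext_zero)

lemma linext_single: "linext T (Poly_Mapping.single \<mu> c) = T \<mu> c"
  by (simp add: linext_def T_zero)

lemma linext_mult:
  assumes "Poly_Mapping.keys p \<subseteq> M" "Poly_Mapping.keys q \<subseteq> M"
  shows "linext T (p * q) = linext T p * linext T q"
proof -
  have "p * q = (\<Sum>\<mu>\<in>Poly_Mapping.keys p. Poly_Mapping.single \<mu> (Poly_Mapping.lookup p \<mu>)) *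
      (\<Sum>\<mu>\<in>Poly_Mapping.keys q. Poly_Mapping.single \<mu> (Poly_Mapping.lookup q \<mu>))"
    by (simp only: poly_mapping_sum_singles)
  also have "\<dots> = (\<Sum>\<mu>\<in>Poly_Mapping.keys p. \<Sum>\<nu>\<in>Poly_Mapping.keys q.
      Poly_Mapping.single (\<mu> + \<nu>) (Poly_Mapping.lookup p \<mu> * Poly_Mapping.lookup q \<nu>))"
    by (simp add: sum_product mult_single)
  also have "linext T \<dots> = (\<Sum>\<mu>\<in>Poly_Mapping.keys p. \<Sum>\<nu>\<in>Poly_Mapping.keys q.
      T \<mu> (Poly_Mapping.lookup p \<mu>) * T \<nu> (Poly_Mapping.lookup q \<nu>))"
    unfolding linext_sum linext_single
    using assms by (intro sum.cong refl T_mult) auto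
  also have "\<dots> = linext T p * linext T q"
    by (simp add: linext_def sum_product)
  finally show ?thesis .
qed

lemma linext_uminus: "linext T (- p) = - linext T p"
  using linext_add[of p "- p"] by (simp add: linext_zero eq_neg_iff_add_eq_0 add.commute)

lemma linext_diff: "linext T (p - q) = linext T p - linext T q"
  using linext_add[of p "- q"] by (simp add: linext_uminus)

end


section \<open>Alternating indeterminates\<close>

text \<open>Eliminates the description in \<open>alt\<close>: the sorted list has distinct entries,
  so a permutation that produces \<open>is\<close> from it is determined at every position.\<close>

lemma alt_eqI:
  assumes "distinct is" "p permutes {..<length is}" "permute_list p (sort is) = is"
  shows "alt is = of_int (sign p) * indet (sort is)"
proof -
  have unique: "q = p" if q: "q permutes {..<length is}" "permute_list q (sort is) = is" for q
  proof
    fix i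
    show "q i = p i"
    proof (cases "i < length is")
      case True
      have "sort is ! q i = sort is ! p i"
        using True q assms permute_list_nth[of q "sort is" i] permute_list_nth[of p "sort is" i]
        by simp
      moreover have "q i < length is" "p i < length is"
        using True permutes_in_image[OF q(1), of i] permutes_in_image[OF assms(2), of i] by auto
      ultimately show ?thesis
        using assms(1) by (simp add: nth_eq_iff_index_eq)
    next
      case False
      then have "q i = i" "p i = i"
        by (auto intro: permutes_not_in[OF q(1)] permutes_not_in[OF assms(2)])
      then show ?thesis by simp
    qed
  qed
  have "(THE q. q permutes {..<length is} \<and> permute_list q (sort is) = is) = p"
    by (rule the_equality) (intro conjI assms, elim conjE, rule unique)
  then show ?thesis using assms(1) by (simp add: alt_def)
qed

text \<open>If p turns the sorted list into \<open>is\<close>, then p composed with q turns it into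
  the permuted list, and the sign is multiplicative.\<close>

lemma alt_permute_list:
  assumes "q permutes {..<length is}"
  shows "alt (permute_list q is) = of_int (sign q) * alt is"
proof (cases "distinct is")
  case True
  have "mset is = mset (sort is)" by simp
  then obtain p where p: "p permutes {..<length (sort is)}" "permute_list p (sort is) = is"
    by (rule mset_eq_permutation)
  then have p': "p permutes {..<length is}" by simp
  have perm: "permutation p" "permutation q"
    using p' assms by (auto simp: permutation_permutes)
  have sort: "sort (permute_list q is) = sort is"
    using assms by (metis mset_permute_list mset_sort properties_for_sort sorted_sort)
  have "alt (permute_list q is) = of_int (sign (p \<circ> q)) * indet (sort (permute_list q is))"
  proof (rule alt_eqI)
    show "distinct (permute_list q is)" using True assms by simp
    show "p \<circ> q permutes {..<length (permute_list q is)}"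
      using permutes_compose[OF assms p'] by simp
    show "permute_list (p \<circ> q) (sort (permute_list q is)) = permute_list q is"
      unfolding sort using permute_list_compose[of q "sort is" p] assms p by simp
  qed
  moreover have "alt is = of_int (sign p) * indet (sort is)"
    using True p' p(2) by (rule alt_eqI)
  ultimately show ?thesis
    unfolding sort sign_compose[OF perm] by simp
next
  case False
  then show ?thesis using assms by (simp add: alt_def)
qed

lemma alt_strict_sorted: "sorted_wrt (<) is \<Longrightarrow> alt is = indet is"
  using alt_eqI[of "is" id] strict_sorted_iff[of "is"]
  by (simp add: permutes_id sign_id sorted_sort_id permute_list_id)

lemma alt_swap12: "alt [j, i, k] = - alt [i, j, k]"
proof -
  have "Transposition.transpose 0 1 permutes {..<length [i, j, k]}"
    by (intro permutes_swap_id) simp_all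
  moreover have "permute_list (Transposition.transpose 0 1) [i, j, k] = [j, i, k]"
    by (simp add: permute_list_def transpose_def)
  ultimately show ?thesis
    using alt_permute_list[of "Transposition.transpose 0 1" "[i, j, k]"] by (simp add: sign_swap_id)
qed

lemma alt_swap23: "alt [i, k, j] = - alt [i, j, k]"
proof -
  have "Transposition.transpose 1 2 permutes {..<length [i, j, k]}"
    by (intro permutes_swap_id) simp_all
  moreover have "permute_list (Transposition.transpose 1 2) [i, j, k] = [i, k, j]"
    by (simp add: permute_list_def transpose_def)
  ultimately show ?thesis
    using alt_permute_list[of "Transposition.transpose 1 2" "[i, j, k]"] by (simp add: sign_swap_id)
qed

lemma alt_repeat: "alt [i, i, k] = 0" "alt [i, k, i] = 0" "alt [k, i, i] = 0"
  by (simp_all add: alt_def)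

text \<open>Adjacent swaps generate all permutations of three indices, so an alternating property
  has to be checked on increasing triples only. The predicate \<open>S\<close> carries symmetric
  side conditions, such as index bounds or the index sum fixed by an induction.\<close>

lemma triple_wlog:
  fixes R :: "'a::linorder \<Rightarrow> 'a \<Rightarrow> 'a \<Rightarrow> bool"
  assumes swap: "\<And>i j k. R i j k \<Longrightarrow> R j i k" and swap': "\<And>i j k. R i j k \<Longrightarrow> R i k j"
    and repeat: "\<And>i k. R i i k"
    and less: "\<And>i j k. i < j \<Longrightarrow> j < k \<Longrightarrow> S i j k \<Longrightarrow> R i j k"
    and S: "\<And>i j k. S i j k \<Longrightarrow> S j i k \<and> S i k j"
    and "S i j k"
  shows "R i j k"
proof -
  have sorted: "R i j k" if "i \<le> j" "j \<le> k" "S i j k" for i j k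
  proof (cases "i = j")
    case True
    then show ?thesis using repeat by simp
  next
    case False
    show ?thesis
    proof (cases "j = k")
      case True
      then show ?thesis using swap[OF swap'[OF repeat]] by simp
    next
      case k: False
      then show ?thesis using False that by (intro less) (auto simp: less_le)
    qed
  qed
  have half: "R i j k" if "i \<le> j" "S i j k" for i j k
  proof -
    consider "j \<le> k" | "k \<le> j" "i \<le> k" | "k \<le> i" by (meson linear)
    then show ?thesis
    proof cases
      case 1
      then show ?thesis using that by (intro sorted)
    next
      case 2
      then show ?thesis
        using S[OF that(2), THEN conjunct2] by (intro swap'[OF sorted])
    next
      case 3
      have "S k i j"
        using S[OF S[OF that(2), THEN conjunct2], THEN conjunct1] .
      then have "R k i j" using 3 that(1) by (intro sorted)
      then show ?thesis by (rule swap'[OF swap])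
    qed
  qed
  show ?thesis
  proof (cases "i \<le> j")
    case True
    then show ?thesis using \<open>S i j k\<close> by (rule half)
  next
    case False
    then show ?thesis
      using S[OF \<open>S i j k\<close>, THEN conjunct1] by (intro swap[OF half]) simp_all
  qed
qed


section \<open>Determinants of three vectors\<close>

definition det3 :: "complex vec \<Rightarrow> complex vec \<Rightarrow> complex vec \<Rightarrow> complex" where
  "det3 a b c = a $ 0 * (b $ 1 * c $ 2 - b $ 2 * c $ 1)
     - a $ 1 * (b $ 0 * c $ 2 - b $ 2 * c $ 0) + a $ 2 * (b $ 0 * c $ 1 - b $ 1 * c $ 0)"

lemma det_mat_of_cols_3: "det (mat_of_cols 3 [a, b, c]) = det3 a b c"
proof -
  have sum2: "(\<Sum>i<2. f i) = f 0 + f 1" and sum3: "(\<Sum>i<3. f i) = f 0 + f 1 + f 2"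
    for f :: "nat \<Rightarrow> complex"
    by (simp_all add: numeral_2_eq_2 numeral_3_eq_3)
  have one: "det (mat (Suc 0) (Suc 0) f) = f (0, 0)" for f :: "nat \<times> nat \<Rightarrow> complex"
    by (subst det_single) simp_all
  have two: "det (mat 2 2 f) = f (0, 0) * f (1, 1) - f (1, 0) * f (0, 1)"
    for f :: "nat \<times> nat \<Rightarrow> complex"
  proof -
    have "det (mat 2 2 f) = (\<Sum>i<2. mat 2 2 f $$ (i, 0) * cofactor (mat 2 2 f) i 0)"
      by (rule laplace_expansion_column) simp_all
    then show ?thesis
      unfolding sum2 by (simp add: cofactor_def mat_delete_def one)
  qed
  have three: "det (mat 3 3 f) = f (0, 0) * (f (1, 1) * f (2, 2) - f (2, 1) * f (1, 2))
      - f (1, 0) * (f (0, 1) * f (2, 2) - f (2, 1) * f (0, 2))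
      + f (2, 0) * (f (0, 1) * f (1, 2) - f (1, 1) * f (0, 2))"
    for f :: "nat \<times> nat \<Rightarrow> complex"
  proof -
    have "det (mat 3 3 f) = (\<Sum>i<3. mat 3 3 f $$ (i, 0) * cofactor (mat 3 3 f) i 0)"
      by (rule laplace_expansion_column) simp_all
    then show ?thesis
      unfolding sum3
      by (simp add: cofactor_def mat_delete_def two[simplified numeral_2_eq_2] numeral_2_eq_2 right_diff_distrib)
  qed
  have "mat_of_cols 3 [a, b, c] = mat 3 3 (\<lambda>(i, j). [a, b, c] ! j $ i)"
    unfolding mat_of_cols_def by (simp add: numeral_3_eq_3)
  then show ?thesis
    unfolding det3_def by (simp add: three nth_Cons' mult.commute)
qed

lemma pdet_3: "pdet 3 v [i, j, k] = det3 (v i) (v j) (v k)"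
  by (simp add: pdet_def det_mat_of_cols_3)

lemma det3_swap12: "det3 b a c = - det3 a b c" and det3_swap23: "det3 a c b = - det3 a b c"
  and det3_repeat: "det3 a a c = 0" "det3 c a a = 0" "det3 a c a = 0"
  by (simp_all add: det3_def algebra_simps)

lemma det3_cyclic: "det3 b c a = det3 a b c"
  by (simp add: det3_def algebra_simps)

text \<open>Four vectors of 3-space satisfy the Cramer dependency a det(b,c,d) - b det(a,c,d) + c
  det(a,b,d) - d det(a,b,c) = 0. Applying the linear functional det(x, y, .) to it gives the
  relation.\<close>

lemma det3_pluecker:
  "det3 x y a * det3 b c d - det3 x y b * det3 a c d + det3 x y c * det3 a b d
    - det3 x y d * det3 a b c = 0"
proof -
  \<comment> \<open>Laplace expansion of a 4 by 4 determinant whose first row repeats one of the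
    other three.\<close>
  have cramer: "u * (b0*(c1*d2-c2*d1)-b1*(c0*d2-c2*d0)+b2*(c0*d1-c1*d0))
      - v * (a0*(c1*d2-c2*d1)-a1*(c0*d2-c2*d0)+a2*(c0*d1-c1*d0))
      + w * (a0*(b1*d2-b2*d1)-a1*(b0*d2-b2*d0)+a2*(b0*d1-b1*d0))
      - z * (a0*(b1*c2-b2*c1)-a1*(b0*c2-b2*c0)+a2*(b0*c1-b1*c0)) = 0"
    if "(u, v, w, z) \<in> {(a0, b0, c0, d0), (a1, b1, c1, d1), (a2, b2, c2, d2)}"
    for u v w z a0 a1 a2 b0 b1 b2 c0 c1 c2 d0 d1 d2 :: complex
    using that by (elim insertE emptyE) (simp_all add: algebra_simps)
  have cramer': "a $ i * det3 b c d - b $ i * det3 a c d + c $ i * det3 a b d - d $ i * det3 a b c = 0"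
    if "i = 0 \<or> i = 1 \<or> i = 2" for i
    unfolding det3_def by (rule cramer) (use that in auto)
  \<comment> \<open>The coefficients are the entries of the cross product of x and y, up to
    sign.\<close>
  have linear: "det3 x y w = (x $ 1 * y $ 2 - x $ 2 * y $ 1) * w $ 0
      - (x $ 0 * y $ 2 - x $ 2 * y $ 0) * w $ 1 + (x $ 0 * y $ 1 - x $ 1 * y $ 0) * w $ 2" for w
    by (simp add: det3_def algebra_simps)
  let ?X = "x $ 1 * y $ 2 - x $ 2 * y $ 1"
  let ?Y = "x $ 0 * y $ 2 - x $ 2 * y $ 0"
  let ?Z = "x $ 0 * y $ 1 - x $ 1 * y $ 0"
  let ?c = "\<lambda>i. a $ i * det3 b c d - b $ i * det3 a c d + c $ i * det3 a b d - d $ i * det3 a b c"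
  have "det3 x y a * det3 b c d - det3 x y b * det3 a c d + det3 x y c * det3 a b d
      - det3 x y d * det3 a b c = ?X * ?c 0 - ?Y * ?c 1 + ?Z * ?c 2"
    unfolding linear[of a] linear[of b] linear[of c] linear[of d] by (simp add: algebra_simps)
  also have "\<dots> = 0"
    unfolding cramer'[OF disjI1[OF refl]] cramer'[OF disjI2[OF disjI1[OF refl]]]
      cramer'[OF disjI2[OF disjI2[OF refl]]] by simp
  finally show ?thesis .
qed


section \<open>Evaluation and shifts\<close>

lemma linear_extension_eval:
  "linear_extension (\<lambda>\<mu> c. c * (\<Prod>i\<in>Poly_Mapping.keys \<mu>. w i powi Poly_Mapping.lookup \<mu> i))
     (mono_in I {i. w i \<noteq> (0::complex)})"
proof
  fix \<mu> \<nu> :: mono and c d :: complex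
  assume mono: "\<mu> \<in> mono_in I {i. w i \<noteq> 0}" "\<nu> \<in> mono_in I {i. w i \<noteq> 0}"
  let ?A = "Poly_Mapping.keys \<mu> \<union> Poly_Mapping.keys \<nu>"
  have extend: "(\<Prod>i\<in>Poly_Mapping.keys \<rho>. w i powi Poly_Mapping.lookup \<rho> i) =
      (\<Prod>i\<in>?A. w i powi Poly_Mapping.lookup \<rho> i)" if "Poly_Mapping.keys \<rho> \<subseteq> ?A" for \<rho>
    using that by (intro prod.mono_neutral_left) (simp_all add: in_keys_iff)
  have "w i powi (Poly_Mapping.lookup \<mu> i + Poly_Mapping.lookup \<nu> i) =
      w i powi Poly_Mapping.lookup \<mu> i * w i powi Poly_Mapping.lookup \<nu> i" for i
  proof (cases "w i = 0")
    case True
    \<comment> \<open>Negative exponents are allowed only where \<open>w\<close> is nonzero, so here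
      both exponents are nonnegative and the additivity of powers of 0 is safe.\<close>
    have "0 \<le> Poly_Mapping.lookup \<rho> i" if "\<rho> \<in> mono_in I {i. w i \<noteq> 0}" for \<rho>
      using that True by (cases "Poly_Mapping.lookup \<rho> i < 0") (simp_all add: mono_in_iff)
    from mono[THEN this] show ?thesis
      by (cases "Poly_Mapping.lookup \<mu> i = 0") (simp_all add: power_int_add)
  qed (simp add: power_int_add)
  then have "(\<Prod>i\<in>?A. w i powi Poly_Mapping.lookup (\<mu> + \<nu>) i) =
      (\<Prod>i\<in>?A. w i powi Poly_Mapping.lookup \<mu> i) * (\<Prod>i\<in>?A. w i powi Poly_Mapping.lookup \<nu> i)"
    by (simp add: lookup_add prod.distrib)
  then show "c * d * (\<Prod>i\<in>Poly_Mapping.keys (\<mu> + \<nu>). w i powi Poly_Mapping.lookup (\<mu> + \<nu>) i) =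
      c * (\<Prod>i\<in>Poly_Mapping.keys \<mu>. w i powi Poly_Mapping.lookup \<mu> i) *
      (d * (\<Prod>i\<in>Poly_Mapping.keys \<nu>. w i powi Poly_Mapping.lookup \<nu> i))"
    using extend[of \<mu>] extend[of \<nu>] extend[of "\<mu> + \<nu>"] Poly_Mapping.keys_add[of \<mu> \<nu>] by simp
qed (simp_all add: algebra_simps)

lemma eval_pdet_linext: "eval_pdet m p v =
    linext (\<lambda>\<mu> c. c * (\<Prod>i\<in>Poly_Mapping.keys \<mu>. pdet m v i powi Poly_Mapping.lookup \<mu> i)) p"
  by (simp add: eval_pdet_def linext_def)

lemma eval_pdet_add: "eval_pdet m (p + q) v = eval_pdet m p v + eval_pdet m q v"
  unfolding eval_pdet_linext by (rule linear_extension.linext_add[OF linear_extension_eval])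

lemma eval_pdet_uminus: "eval_pdet m (- p) v = - eval_pdet m p v"
  unfolding eval_pdet_linext by (rule linear_extension.linext_uminus[OF linear_extension_eval])

lemma eval_pdet_diff: "eval_pdet m (p - q) v = eval_pdet m p v - eval_pdet m q v"
  unfolding eval_pdet_linext by (rule linear_extension.linext_diff[OF linear_extension_eval])

lemma eval_pdet_sum: "eval_pdet m (sum f A) v = (\<Sum>x\<in>A. eval_pdet m (f x) v)"
  unfolding eval_pdet_linext by (rule linear_extension.linext_sum[OF linear_extension_eval])

lemma eval_pdet_mult:
  assumes "p \<in> laurent_in I S" "q \<in> laurent_in I S" "\<And>i. i \<in> S \<Longrightarrow> pdet m v i \<noteq> 0"
  shows "eval_pdet m (p * q) v = eval_pdet m p v * eval_pdet m q v"
proof -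
  have "laurent_in I S \<subseteq> laurent_in I {i. pdet m v i \<noteq> 0}"
    using assms(3) by (intro laurent_in_mono) auto
  then have "Poly_Mapping.keys p \<subseteq> mono_in I {i. pdet m v i \<noteq> 0}"
    "Poly_Mapping.keys q \<subseteq> mono_in I {i. pdet m v i \<noteq> 0}"
    using assms(1,2) by (simp_all only: flip: laurent_in_iff) (erule (1) subsetD)+
  then show ?thesis
    unfolding eval_pdet_linext by (rule linear_extension.linext_mult[OF linear_extension_eval])
qed

lemma eval_pdet_const: "eval_pdet m (const c) v = c"
  by (cases "c = 0") (simp_all add: eval_pdet_def const_def)

lemma eval_pdet_zero: "eval_pdet m 0 v = 0"
  by (simp add: eval_pdet_def)

lemma eval_pdet_one: "eval_pdet m 1 v = 1"
  using eval_pdet_const[of m 1 v] by (simp add: const_1)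

lemma eval_pdet_indet: "eval_pdet m (indet is) v = pdet m v is"
  by (simp add: eval_pdet_def indet_def)

lemma eval_pdet_inv_indet: "eval_pdet m (inv_indet is) v = inverse (pdet m v is)"
  by (simp add: eval_pdet_def inv_indet_def power_int_minus)

lemma eval_pdet_alt: "eval_pdet 3 (alt [i, j, k]) v = pdet 3 v [i, j, k]"
proof (rule triple_wlog[where S = "\<lambda>_ _ _. True" and R = "\<lambda>i j k. eval_pdet 3 (alt [i, j, k]) v = pdet 3 v [i, j, k]"])
  fix i j k
  assume *: "eval_pdet 3 (alt [i, j, k]) v = pdet 3 v [i, j, k]"
  show "eval_pdet 3 (alt [j, i, k]) v = pdet 3 v [j, i, k]"
    unfolding alt_swap12[of j i k] eval_pdet_uminus * pdet_3 by (rule det3_swap12[symmetric])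
  show "eval_pdet 3 (alt [i, k, j]) v = pdet 3 v [i, k, j]"
    unfolding alt_swap23[of i k j] eval_pdet_uminus * pdet_3 by (rule det3_swap23[symmetric])
next
  fix i k
  show "eval_pdet 3 (alt [i, i, k]) v = pdet 3 v [i, i, k]"
    unfolding alt_repeat eval_pdet_zero pdet_3 by (rule det3_repeat(1)[symmetric])
next
  fix i j k :: int
  assume "i < j" "j < k"
  then show "eval_pdet 3 (alt [i, j, k]) v = pdet 3 v [i, j, k]"
    by (subst alt_strict_sorted) (simp_all add: eval_pdet_indet)
qed simp_all

lemma eval_pdet_cong:
  assumes "p \<in> laurent_in I S" "\<And>is k. is \<in> I \<Longrightarrow> k \<in> set is \<Longrightarrow> u k = v k"
  shows "eval_pdet m p u = eval_pdet m p v"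
proof -
  have pdet: "pdet m u is = pdet m v is" if "is \<in> I" for "is"
  proof -
    have "map u is = map v is" using that assms(2) by (intro map_cong refl)
    then show ?thesis unfolding pdet_def by (rule arg_cong)
  qed
  have I: "is \<in> I" if "\<mu> \<in> Poly_Mapping.keys p" "is \<in> Poly_Mapping.keys \<mu>" for \<mu> "is"
    using assms(1) that by (simp add: laurent_in_def)
  show ?thesis
    unfolding eval_pdet_def by (intro sum.cong arg_cong2[of _ _ _ _ "(*)"] prod.cong
        arg_cong2[of _ _ _ _ "(powi)"] refl pdet) (rule I)
qed

section \<open>Index shifts of monomials and Laurent polynomials\<close>

lemma shift_mono_add: "shift_mono t (\<mu> + \<nu>) = shift_mono t \<mu> + shift_mono t \<nu>"
  unfolding shift_mono_def by (rule setsum_keys_plus_distrib) (simp_all add: single_add)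

lemma shift_mono_single: "shift_mono t (Poly_Mapping.single is n) = Poly_Mapping.single (map (\<lambda>k. k + t) is) n"
  by (cases "n = 0") (simp_all add: shift_mono_def)

lemma linear_extension_shift: "linear_extension (\<lambda>\<mu>. Poly_Mapping.single (shift_mono t \<mu>)) UNIV"
  by standard (simp_all add: shift_mono_add single_add mult_single)

lemma shift_laurent_linext: "shift_laurent t p = linext (\<lambda>\<mu>. Poly_Mapping.single (shift_mono t \<mu>)) p"
  by (simp add: shift_laurent_def linext_def)

lemma shift_laurent_add: "shift_laurent t (p + q) = shift_laurent t p + shift_laurent t q"
  unfolding shift_laurent_linext by (rule linear_extension.linext_add[OF linear_extension_shift])

lemma shift_laurent_uminus: "shift_laurent t (- p) = - shift_laurent t p"
  unfolding shift_laurent_linext by (rule linear_extension.linext_uminus[OF linear_extension_shift])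

lemma shift_laurent_sum: "shift_laurent t (sum f A) = (\<Sum>x\<in>A. shift_laurent t (f x))"
  unfolding shift_laurent_linext by (rule linear_extension.linext_sum[OF linear_extension_shift])

lemma shift_laurent_mult: "shift_laurent t (p * q) = shift_laurent t p * shift_laurent t q"
  unfolding shift_laurent_linext by (rule linear_extension.linext_mult[OF linear_extension_shift]) simp_all

lemma shift_laurent_const: "shift_laurent t (const c) = const c"
  by (cases "c = 0") (simp_all add: shift_laurent_def const_def shift_mono_def)

lemma shift_laurent_zero: "shift_laurent t 0 = 0" and shift_laurent_one: "shift_laurent t 1 = 1"
  using shift_laurent_const[of t 0] shift_laurent_const[of t 1] by (simp_all add: const_0 const_1)

lemma shift_laurent_of_int: "shift_laurent t (of_int n) = of_int n"
  using shift_laurent_const[of t "of_int n"] by (simp add: const_def)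

lemma shift_laurent_indet: "shift_laurent t (indet is) = indet (map (\<lambda>k. k + t) is)"
  by (simp add: shift_laurent_def indet_def shift_mono_single)

lemma shift_laurent_inv_indet: "shift_laurent t (inv_indet is) = inv_indet (map (\<lambda>k. k + t) is)"
  by (simp add: shift_laurent_def inv_indet_def shift_mono_single)

lemma sort_map_shift: "sort (map (\<lambda>k. k + t) is) = map (\<lambda>k. k + t) (sort is)" for t :: int
  by (rule properties_for_sort) (simp_all add: sorted_map)

text \<open>A shift is monotone, hence commutes with sorting, and one permutation serves for both
  lists.\<close>

lemma shift_laurent_alt: "shift_laurent t (alt is) = alt (map (\<lambda>k. k + t) is)"
proof (cases "distinct is")
  case True
  have "mset is = mset (sort is)" by simp
  then obtain p where p: "p permutes {..<length (sort is)}" "permute_list p (sort is) = is"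
    by (rule mset_eq_permutation)
  then have p': "p permutes {..<length is}" by simp
  have "alt is = of_int (sign p) * indet (sort is)"
    using True p' p(2) by (rule alt_eqI)
  moreover have "alt (map (\<lambda>k. k + t) is) = of_int (sign p) * indet (sort (map (\<lambda>k. k + t) is))"
  proof (rule alt_eqI)
    show "distinct (map (\<lambda>k. k + t) is)" using True by (simp add: distinct_map)
    show "p permutes {..<length (map (\<lambda>k. k + t) is)}" using p' by simp
    show "permute_list p (sort (map (\<lambda>k. k + t) is)) = map (\<lambda>k. k + t) is"
      unfolding sort_map_shift permute_list_map[OF p(1)] p(2) ..
  qed
  ultimately show ?thesis
    by (simp add: shift_laurent_mult shift_laurent_of_int shift_laurent_indet sort_map_shift)
next
  case False
  then show ?thesis by (simp add: alt_def distinct_map shift_laurent_zero)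
qed

lemma shift_laurent_in:
  assumes p: "p \<in> laurent_in I S"
    and I: "\<And>is. is \<in> I \<Longrightarrow> map (\<lambda>k. k + t) is \<in> I'" and S: "\<And>is. is \<in> S \<Longrightarrow> map (\<lambda>k. k + t) is \<in> S'"
  shows "shift_laurent t p \<in> laurent_in I' S'"
  using p
proof (induction rule: laurent_in_induct)
  case (const c)
  show ?case unfolding shift_laurent_const by (rule laurent_in_const)
next
  case (indet i)
  then show ?case unfolding shift_laurent_indet by (intro laurent_in_indet I)
next
  case (inv i)
  then show ?case unfolding shift_laurent_inv_indet by (intro laurent_in_inv_indet I S)
next
  case (add p q)
  then show ?case unfolding shift_laurent_add by (intro laurent_in_add)
next
  case (mult p q)
  then show ?case unfolding shift_laurent_mult by (intro laurent_in_mult)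
qed

lemma shift_laurent_shift_laurent: "shift_laurent s (shift_laurent t p) = shift_laurent (t + s) p"
proof -
  have "p \<in> laurent_in UNIV UNIV" by (simp add: laurent_in_def)
  then show ?thesis
    by (induction rule: laurent_in_induct)
      (simp_all add: shift_laurent_const shift_laurent_indet shift_laurent_inv_indet
        shift_laurent_add shift_laurent_mult comp_def add.assoc)
qed

lemma shift_laurent_by_zero: "shift_laurent 0 p = p"
proof -
  have "p \<in> laurent_in UNIV UNIV" by (simp add: laurent_in_def)
  then show ?thesis
    by (induction rule: laurent_in_induct)
      (simp_all add: shift_laurent_const shift_laurent_indet shift_laurent_inv_indet
        shift_laurent_add shift_laurent_mult)
qed


section \<open>The quotient rings\<close>

lemma carrier_laurent_ring [simp]: "carrier (laurent_ring m) = laurent_in (tuples m) (frozen m)"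
  and mult_laurent_ring [simp]: "x \<otimes>\<^bsub>laurent_ring m\<^esub> y = x * y"
  and add_laurent_ring [simp]: "x \<oplus>\<^bsub>laurent_ring m\<^esub> y = x + y"
  and one_laurent_ring [simp]: "\<one>\<^bsub>laurent_ring m\<^esub> = 1"
  and zero_laurent_ring [simp]: "\<zero>\<^bsub>laurent_ring m\<^esub> = 0"
  by (simp_all add: laurent_ring_def)

lemma cring_laurent_ring: "cring (laurent_ring m)"
proof (intro cringI abelian_groupI comm_monoidI)
  fix x assume "x \<in> carrier (laurent_ring m)"
  then have "- x \<in> carrier (laurent_ring m)" by (simp add: laurent_in_uminus)
  then show "\<exists>y\<in>carrier (laurent_ring m). y \<oplus>\<^bsub>laurent_ring m\<^esub> x = \<zero>\<^bsub>laurent_ring m\<^esub>"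
    by (intro bexI[of _ "- x"]) simp_all
qed (simp_all add: laurent_in_intros algebra_simps)

interpretation laurent_ring: cring "laurent_ring m" for m
  by (rule cring_laurent_ring)

lemma a_inv_laurent_ring: "q \<in> laurent_in (tuples m) (frozen m) \<Longrightarrow> \<ominus>\<^bsub>laurent_ring m\<^esub> q = - q"
  using laurent_ring.minus_equality[of _ "- q" q] by (simp add: laurent_in_uminus)

lemma ring_hom_diff:
  assumes "ring_hom_cring (laurent_ring m) R h"
    and p: "p \<in> laurent_in (tuples m) (frozen m)" and q: "q \<in> laurent_in (tuples m) (frozen m)"
  shows "h (p - q) = h p \<ominus>\<^bsub>R\<^esub> h q"
proof -
  interpret ring_hom_cring "laurent_ring m" R h by (rule assms(1))
  have "h (- q) = \<ominus>\<^bsub>R\<^esub> h q" using hom_a_inv[of q] a_inv_laurent_ring[OF q] q by simp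
  then show ?thesis
    using hom_add[of p "- q"] p laurent_in_uminus[OF q] by (simp add: a_minus_def)
qed

lemma frozen_subset_tuples: "frozen m \<subseteq> tuples m"
proof
  fix "is" assume "is \<in> frozen m"
  then obtain i where "is = [i..i + int m - 1]" by (auto simp: frozen_def)
  then show "is \<in> tuples m"
    by (simp add: tuples_def strict_sorted_iff)
qed

lemma alt_in: "length is = m \<Longrightarrow> alt is \<in> laurent_in (tuples m) S"
proof (cases "distinct is")
  case True
  assume "length is = m"
  then have "sort is \<in> tuples m" using True by (simp add: tuples_def strict_sorted_iff)
  then show ?thesis using True by (simp add: alt_def laurent_in_mult laurent_in_of_int laurent_in_indet)
next
  case False
  then show ?thesis by (simp add: alt_def laurent_in_zero)
qed

abbreviation pluecker_rels :: "nat \<Rightarrow> laurent set" where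
  "pluecker_rels m \<equiv> {pluecker_rel m is js | is js. is \<in> tuples (m - 1) \<and> js \<in> tuples (m + 1)}"

lemma pluecker_rels_in:
  assumes "0 < m" shows "pluecker_rels m \<subseteq> laurent_in (tuples m) (frozen m)"
proof
  fix p assume "p \<in> pluecker_rels m"
  then obtain "is" js where p: "p = pluecker_rel m is js" and len: "length is = m - 1" "length js = m + 1"
    by (auto simp: tuples_def)
  have "alt (take (t - 1) js @ drop t js) \<in> laurent_in (tuples m) (frozen m)" if "t \<in> {1..m + 1}" for t
    using that len by (intro alt_in) auto
  moreover have "alt (is @ [j]) \<in> laurent_in (tuples m) (frozen m)" for j
    using len assms by (intro alt_in) simp
  ultimately show "p \<in> laurent_in (tuples m) (frozen m)"
    unfolding p pluecker_rel_def
    by (intro laurent_in_sum laurent_in_mult laurent_in_power laurent_in_uminus laurent_in_one)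
qed

lemma pluecker_ideal: "0 < m \<Longrightarrow> ideal (pluecker_ideal m) (laurent_ring m)"
  unfolding pluecker_ideal_def using pluecker_rels_in[of m] by (intro laurent_ring.genideal_ideal) simp

lemma cring_GG: "0 < m \<Longrightarrow> cring (GG m)"
  unfolding GG_def by (rule ideal.quotient_is_cring[OF pluecker_ideal cring_laurent_ring])

lemma GG_class_hom: "0 < m \<Longrightarrow> GG_class m \<in> Ring.ring_hom (laurent_ring m) (GG m)"
  unfolding GG_def GG_class_def[abs_def] by (rule ideal.rcos_ring_hom[OF pluecker_ideal])

lemma GG_class_in: "0 < m \<Longrightarrow> p \<in> laurent_in (tuples m) (frozen m) \<Longrightarrow> GG_class m p \<in> carrier (GG m)"
  using ring_hom_closed[OF GG_class_hom] by simp

lemma GG_class_hom_cring: "0 < m \<Longrightarrow> ring_hom_cring (laurent_ring m) (GG m) (GG_class m)"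
  by (intro ring_hom_cringI cring_laurent_ring cring_GG GG_class_hom)

abbreviation frozen_rels :: "nat \<Rightarrow> laurent set set" where
  "frozen_rels m \<equiv> {GG_class m (indet j) \<ominus>\<^bsub>GG m\<^esub> \<one>\<^bsub>GG m\<^esub> | j. j \<in> frozen m}"

lemma indet_frozen_in: "j \<in> frozen m \<Longrightarrow> indet j \<in> laurent_in (tuples m) (frozen m)"
  using frozen_subset_tuples by (intro laurent_in_indet) (rule subsetD)

lemma inv_indet_frozen_in: "j \<in> frozen m \<Longrightarrow> inv_indet j \<in> laurent_in (tuples m) (frozen m)"
  using frozen_subset_tuples by (intro laurent_in_inv_indet) (rule subsetD)

lemmas GG_class_diff = ring_hom_diff[OF GG_class_hom_cring]

lemma GG_class_one: "0 < m \<Longrightarrow> GG_class m 1 = \<one>\<^bsub>GG m\<^esub>"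
  using ring_hom_one[OF GG_class_hom, of m] by simp

lemma frozen_rels_eq:
  assumes "0 < m" shows "frozen_rels m = GG_class m ` (\<lambda>j. indet j - 1) ` frozen m"
proof -
  have "frozen_rels m = (\<lambda>j. GG_class m (indet j) \<ominus>\<^bsub>GG m\<^esub> \<one>\<^bsub>GG m\<^esub>) ` frozen m"
    by (rule Setcompr_eq_image)
  also have "\<dots> = (\<lambda>j. GG_class m (indet j - 1)) ` frozen m"
    using assms by (intro image_cong refl)
      (simp add: GG_class_diff indet_frozen_in laurent_in_one GG_class_one)
  finally show ?thesis by (simp only: image_image)
qed

lemma frozen_rels_in:
  assumes "0 < m" shows "frozen_rels m \<subseteq> carrier (GG m)"
  unfolding frozen_rels_eq[OF assms]
  unfolding image_image
  by (intro image_subsetI GG_class_in[OF assms] laurent_in_diff indet_frozen_in laurent_in_one)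

lemma frozen_ideal: "0 < m \<Longrightarrow> ideal (frozen_ideal m) (GG m)"
  unfolding frozen_ideal_def
  by (intro ring.genideal_ideal cring.axioms(1) cring_GG frozen_rels_in)

lemma cring_GGbar: "0 < m \<Longrightarrow> cring (GGbar m)"
  unfolding GGbar_def by (rule ideal.quotient_is_cring[OF frozen_ideal cring_GG])

lemma GGbar_class_hom: "0 < m \<Longrightarrow> ring_hom_cring (laurent_ring m) (GGbar m) (GGbar_class m)"
proof -
  assume m: "0 < m"
  have "GGbar_class m = (+>\<^bsub>GG m\<^esub>) (frozen_ideal m) \<circ> GG_class m"
    by (simp add: GGbar_class_def fun_eq_iff)
  then have "GGbar_class m \<in> Ring.ring_hom (laurent_ring m) (GGbar m)"
    using ring_hom_trans[OF GG_class_hom[OF m] ideal.rcos_ring_hom[OF frozen_ideal[OF m]]]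
    by (simp add: GGbar_def)
  then show ?thesis
    using m by (intro ring_hom_cringI cring_laurent_ring cring_GGbar)
qed

text \<open>Elements of the iterated quotient are cosets of cosets. Pulling the zero class back to
  Laurent polynomials replaces the two quotients by one ideal, and equality of classes by membership
  of a difference.\<close>

definition GGbar_kernel :: "nat \<Rightarrow> laurent set" where
  "GGbar_kernel m = a_kernel (laurent_ring m) (GGbar m) (GGbar_class m)"

lemma GGbar_kernel_ideal:
  assumes "0 < m" shows "ideal (GGbar_kernel m) (laurent_ring m)"
proof -
  interpret ring_hom_cring "laurent_ring m" "GGbar m" "GGbar_class m"
    using assms by (rule GGbar_class_hom)
  have "ring_hom_ring (laurent_ring m) (GGbar m) (GGbar_class m)"
    by (rule ring_hom_ringI2[OF laurent_ring.ring_axioms S.ring_axioms homh])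
  then show ?thesis unfolding GGbar_kernel_def by (rule ring_hom_ring.kernel_is_ideal)
qed

lemma GGbar_class_eq_iff:
  assumes "0 < m" "p \<in> laurent_in (tuples m) (frozen m)" "q \<in> laurent_in (tuples m) (frozen m)"
  shows "GGbar_class m p = GGbar_class m q \<longleftrightarrow> p - q \<in> GGbar_kernel m"
proof -
  interpret ring_hom_cring "laurent_ring m" "GGbar m" "GGbar_class m"
    using assms(1) by (rule GGbar_class_hom)
  have "GGbar_class m p \<in> carrier (GGbar m)" "GGbar_class m q \<in> carrier (GGbar m)"
    by (rule hom_closed; simp only: carrier_laurent_ring assms)+
  then have diff: "GGbar_class m p \<ominus>\<^bsub>GGbar m\<^esub> GGbar_class m q = \<zero>\<^bsub>GGbar m\<^esub> \<longleftrightarrow>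
      GGbar_class m p = GGbar_class m q"
    by (rule S.r_right_minus_eq)
  have "p - q \<in> GGbar_kernel m \<longleftrightarrow> GGbar_class m (p - q) = \<zero>\<^bsub>GGbar m\<^esub>"
    unfolding GGbar_kernel_def a_kernel_def' carrier_laurent_ring mem_Collect_eq
    using laurent_in_diff[OF assms(2,3)] by blast
  also have "\<dots> \<longleftrightarrow> GGbar_class m p = GGbar_class m q"
    unfolding ring_hom_diff[OF ring_hom_cring_axioms assms(2,3)] by (rule diff)
  finally show ?thesis by (rule sym)
qed

lemma
  assumes "0 < m"
  shows GGbar_kernel_subset: "GGbar_kernel m \<subseteq> laurent_in (tuples m) (frozen m)"
    and GGbar_kernel_zero: "0 \<in> GGbar_kernel m"
    and GGbar_kernel_add: "p \<in> GGbar_kernel m \<Longrightarrow> q \<in> GGbar_kernel m \<Longrightarrow> p + q \<in> GGbar_kernel m"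
    and GGbar_kernel_mult: "p \<in> GGbar_kernel m \<Longrightarrow> q \<in> laurent_in (tuples m) (frozen m) \<Longrightarrow> p * q \<in> GGbar_kernel m"
proof -
  interpret ideal "GGbar_kernel m" "laurent_ring m" using assms by (rule GGbar_kernel_ideal)
  show "GGbar_kernel m \<subseteq> laurent_in (tuples m) (frozen m)" using a_subset by simp
  show "0 \<in> GGbar_kernel m" using additive_subgroup.zero_closed[OF is_additive_subgroup] by simp
  show "p + q \<in> GGbar_kernel m" if "p \<in> GGbar_kernel m" "q \<in> GGbar_kernel m"
    using a_closed[OF that] by simp
  show "p * q \<in> GGbar_kernel m" if "p \<in> GGbar_kernel m" "q \<in> laurent_in (tuples m) (frozen m)"
    using I_r_closed[OF that(1), of q] that(2) by simp
qed

lemma GGbar_kernel_uminus: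
  assumes "0 < m" "p \<in> GGbar_kernel m" shows "- p \<in> GGbar_kernel m"
proof -
  have "p * of_int (- 1) \<in> GGbar_kernel m"
    using assms by (rule GGbar_kernel_mult) (rule laurent_in_of_int)
  then show ?thesis by simp
qed

lemma GGbar_kernel_diff:
  "0 < m \<Longrightarrow> p \<in> GGbar_kernel m \<Longrightarrow> q \<in> GGbar_kernel m \<Longrightarrow> p - q \<in> GGbar_kernel m"
  using GGbar_kernel_add[of m p "- q"] GGbar_kernel_uminus[of m q] by simp

lemma GGbar_kernelI:
  assumes "0 < m" "p \<in> laurent_in (tuples m) (frozen m)" "GG_class m p \<in> frozen_ideal m"
  shows "p \<in> GGbar_kernel m"
proof -
  interpret ideal "frozen_ideal m" "GG m" using assms(1) by (rule frozen_ideal)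
  have "GGbar_class m p = \<zero>\<^bsub>GGbar m\<^esub>"
    using a_rcos_const[OF assms(3)] by (simp add: GGbar_class_def GGbar_def FactRing_def)
  then show ?thesis using assms(2) by (simp add: GGbar_kernel_def a_kernel_def')
qed

lemma pluecker_rel_kernel:
  assumes "0 < m" "is \<in> tuples (m - 1)" "js \<in> tuples (m + 1)"
  shows "pluecker_rel m is js \<in> GGbar_kernel m"
proof -
  interpret I: ideal "pluecker_ideal m" "laurent_ring m" using assms(1) by (rule pluecker_ideal)
  interpret J: ideal "frozen_ideal m" "GG m" using assms(1) by (rule frozen_ideal)
  have rel: "pluecker_rel m is js \<in> pluecker_rels m" using assms by blast
  then have "pluecker_rel m is js \<in> pluecker_ideal m"
    unfolding pluecker_ideal_def
    using laurent_ring.genideal_self[of "pluecker_rels m" m] pluecker_rels_in[OF assms(1)] by auto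
  then have "GG_class m (pluecker_rel m is js) = \<zero>\<^bsub>GG m\<^esub>"
    using I.a_rcos_const by (simp add: GG_class_def GG_def FactRing_def)
  moreover have "\<zero>\<^bsub>GG m\<^esub> \<in> frozen_ideal m"
    by (rule additive_subgroup.zero_closed[OF J.is_additive_subgroup])
  ultimately show ?thesis
    using assms(1) rel pluecker_rels_in[OF assms(1)] by (intro GGbar_kernelI) (simp_all add: subset_iff)
qed

lemma indet_frozen_kernel:
  assumes "0 < m" "j \<in> frozen m" shows "indet j - 1 \<in> GGbar_kernel m"
proof (rule GGbar_kernelI[OF assms(1)])
  show "indet j - 1 \<in> laurent_in (tuples m) (frozen m)"
    using assms(2) by (intro laurent_in_diff indet_frozen_in laurent_in_one)
  have "frozen_rels m \<subseteq> frozen_ideal m"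
    unfolding frozen_ideal_def
    using assms(1) by (intro ring.genideal_self cring.axioms(1) cring_GG frozen_rels_in)
  moreover have "GG_class m (indet j - 1) \<in> frozen_rels m"
    unfolding frozen_rels_eq[OF assms(1)] using assms(2) by (intro imageI)
  ultimately show "GG_class m (indet j - 1) \<in> frozen_ideal m" by (rule subsetD)
qed

text \<open>Since \<open>GG_class\<close> is onto, the second ideal can be described by
  representatives. Both the minimality of the kernel and the elementwise description of cosets of
  cosets rest on this.\<close>

lemma frozen_ideal_eq:
  assumes m: "0 < m" shows "frozen_ideal m = GG_class m ` GGbar_kernel m"
proof (intro equalityI subsetI)
  interpret J: ideal "frozen_ideal m" "GG m" using m by (rule frozen_ideal)
  fix X
  {
    assume X: "X \<in> frozen_ideal m"
    then have "X \<in> carrier (GG m)" by (rule J.a_Hcarr)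
    then obtain p where p: "p \<in> laurent_in (tuples m) (frozen m)" "X = GG_class m p"
      by (auto simp: GG_def GG_class_def FactRing_def A_RCOSETS_def')
    have "p \<in> GGbar_kernel m" using m p X by (intro GGbar_kernelI) simp_all
    then show "X \<in> GG_class m ` GGbar_kernel m" unfolding p(2) by (rule imageI)
  next
    assume "X \<in> GG_class m ` GGbar_kernel m"
    then obtain p where p: "p \<in> GGbar_kernel m" "X = GG_class m p" by (rule imageE)
    have pC: "p \<in> laurent_in (tuples m) (frozen m)" and "GGbar_class m p = \<zero>\<^bsub>GGbar m\<^esub>"
      using p by (simp_all add: GGbar_kernel_def a_kernel_def')
    then have "frozen_ideal m +>\<^bsub>GG m\<^esub> GG_class m p = frozen_ideal m"
      by (simp add: GGbar_class_def GGbar_def FactRing_def)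
    then show "X \<in> frozen_ideal m"
      unfolding p(2) using J.a_rcos_self[OF GG_class_in[OF m pC]] by simp
  }
qed

text \<open>Correspondence of ideals: \<open>A\<close> contains the Pluecker ideal, its image in
  \<open>GG\<close> is an ideal, and whatever is congruent to an element of \<open>A\<close> modulo
  the Pluecker ideal lies in \<open>A\<close>. This acts as an induction over the generators of the
  kernel.\<close>

lemma GGbar_kernel_minimal:
  assumes m: "0 < m" and A: "ideal A (laurent_ring m)"
    and rels: "pluecker_rels m \<subseteq> A" and frozen: "\<And>j. j \<in> frozen m \<Longrightarrow> indet j - 1 \<in> A"
  shows "GGbar_kernel m \<subseteq> A"
proof
  fix p assume p: "p \<in> GGbar_kernel m"
  interpret A: ideal A "laurent_ring m" by (rule A)
  interpret I: ideal "pluecker_ideal m" "laurent_ring m" using m by (rule pluecker_ideal)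
  interpret J: ideal "frozen_ideal m" "GG m" using m by (rule frozen_ideal)
  have I: "pluecker_ideal m \<subseteq> A"
    unfolding pluecker_ideal_def using A rels by (rule laurent_ring.genideal_minimal)
  have "ideal (GG_class m ` A) (GG m)"
    using laurent_ring.ring_ideal_imp_quot_ideal[OF I.is_ideal A] by (simp add: GG_def GG_class_def[abs_def])
  moreover have "frozen_rels m \<subseteq> GG_class m ` A"
    unfolding frozen_rels_eq[OF m] using frozen by (intro image_mono image_subsetI)
  ultimately have J: "frozen_ideal m \<subseteq> GG_class m ` A"
    unfolding frozen_ideal_def by (intro ring.genideal_minimal cring.axioms(1) cring_GG m)
  have pC: "p \<in> laurent_in (tuples m) (frozen m)"
    using GGbar_kernel_subset[OF m] p by (rule subsetD)
  have "GG_class m p \<in> frozen_ideal m"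
    unfolding frozen_ideal_eq[OF m] using p by (rule imageI)
  then obtain a where a: "a \<in> A" "GG_class m p = GG_class m a" using J by blast
  then have "p \<in> pluecker_ideal m +>\<^bsub>laurent_ring m\<^esub> a"
    using I.a_rcos_self[of p] pC by (simp add: GG_class_def)
  then obtain i where "i \<in> pluecker_ideal m" "p = i + a"
    by (auto simp: a_r_coset_def')
  then show "p \<in> A" using I a(1) A.a_closed[of i a] by (simp add: subset_iff)
qed

section \<open>Evaluation at vectors of elements of the kernel\<close>

lemma eval_pdet_pluecker_rel:
  assumes "length is = 2" "length js = 4"
  shows "eval_pdet 3 (pluecker_rel 3 is js) v = 0"
proof -
  obtain x y where "is": "is = [x, y]" using assms(1) by (auto simp: length_Suc_conv numeral_2_eq_2)
  obtain a b c d where js: "js = [a, b, c, d]"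
    using assms(2) by (auto simp: length_Suc_conv eval_nat_numeral)
  have rel: "pluecker_rel 3 is js =
      alt [x, y, b] * alt [a, c, d] - alt [x, y, a] * alt [b, c, d] - alt [x, y, c] * alt [a, b, d]
        + alt [x, y, d] * alt [a, b, c]"
    by (simp add: pluecker_rel_def "is" js eval_nat_numeral)
  have alt: "alt [i, j, k] \<in> laurent_in (tuples 3) {}" for i j k
    by (rule alt_in) simp
  have "eval_pdet 3 (alt [i, j, k] * alt [i', j', k']) v = pdet 3 v [i, j, k] * pdet 3 v [i', j', k']"
    for i j k i' j' k'
    by (subst eval_pdet_mult[OF alt alt]) (simp_all add: eval_pdet_alt)
  then show ?thesis
    unfolding rel eval_pdet_add eval_pdet_diff pdet_3
    using det3_pluecker[of "v x" "v y" "v a" "v b" "v c" "v d"] by (simp add: algebra_simps)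
qed

theorem eval_pdet_kernel:
  assumes p: "p \<in> GGbar_kernel 3" and v: "\<And>j. j \<in> frozen 3 \<Longrightarrow> pdet 3 v j = 1"
  shows "eval_pdet 3 p v = 0"
proof -
  let ?C = "laurent_in (tuples 3) (frozen 3)"
  let ?A = "{p \<in> ?C. eval_pdet 3 p v = 0}"
  have mult: "eval_pdet 3 (p * q) v = eval_pdet 3 p v * eval_pdet 3 q v" if "p \<in> ?C" "q \<in> ?C" for p q
    using that by (rule eval_pdet_mult) (simp add: v)
  have "ideal ?A (laurent_ring 3)"
  proof (rule idealI)
    show "ring (laurent_ring 3)" by (rule laurent_ring.ring_axioms)
    show "subgroup ?A (add_monoid (laurent_ring 3))"
    proof (intro subgroup.intro)
      fix x assume x: "x \<in> ?A"
      have "inv\<^bsub>add_monoid (laurent_ring 3)\<^esub> x = - x"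
        using x laurent_ring.minus_equality[of _ "- x" x] by (simp add: a_inv_def laurent_in_uminus)
      then show "inv\<^bsub>add_monoid (laurent_ring 3)\<^esub> x \<in> ?A"
        using x by (simp add: laurent_in_uminus eval_pdet_uminus)
    qed (auto simp: laurent_in_zero laurent_in_add eval_pdet_add eval_pdet_zero)
  qed (auto simp: mult laurent_in_mult)
  moreover have "pluecker_rels 3 \<subseteq> ?A"
    using pluecker_rels_in[of 3] by (auto simp: tuples_def eval_pdet_pluecker_rel)
  moreover have "indet j - 1 \<in> ?A" if "j \<in> frozen 3" for j
    using that by (simp add: laurent_in_diff indet_frozen_in laurent_in_one eval_pdet_diff
        eval_pdet_indet eval_pdet_one v)
  ultimately have "GGbar_kernel 3 \<subseteq> ?A" by (intro GGbar_kernel_minimal) simp_all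
  with p show ?thesis by blast
qed


section \<open>Polynomial functions and congruences\<close>

lemma GGbar_kernel_in: "p \<in> GGbar_kernel 3 \<Longrightarrow> p \<in> laurent_in (tuples 3) (frozen 3)"
  using GGbar_kernel_subset[of 3] by (rule subsetD) simp_all

lemmas kernel3_zero = GGbar_kernel_zero[of 3, OF zero_less_numeral]
  and kernel3_add = GGbar_kernel_add[of 3, OF zero_less_numeral]
  and kernel3_mult = GGbar_kernel_mult[of 3, OF zero_less_numeral]
  and kernel3_uminus = GGbar_kernel_uminus[of 3, OF zero_less_numeral]
  and kernel3_diff = GGbar_kernel_diff[of 3, OF zero_less_numeral]

lemma kernel3_mult_diff:
  assumes "p - p' \<in> GGbar_kernel 3" "q - q' \<in> GGbar_kernel 3"
    and "q \<in> laurent_in (tuples 3) (frozen 3)" "p' \<in> laurent_in (tuples 3) (frozen 3)"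
  shows "p * q - p' * q' \<in> GGbar_kernel 3"
proof -
  have "p * q - p' * q' = (p - p') * q + (q - q') * p'" by (simp add: algebra_simps)
  then show ?thesis using assms by (simp only: kernel3_add kernel3_mult)
qed

lemma inv_indet_frozen_kernel:
  assumes "j \<in> frozen 3" shows "inv_indet j - 1 \<in> GGbar_kernel 3"
proof -
  have "- (indet j - 1) * inv_indet j \<in> GGbar_kernel 3"
    by (intro kernel3_mult kernel3_uminus indet_frozen_kernel inv_indet_frozen_in assms) simp
  also have "- (indet j - 1) * inv_indet j = inv_indet j - 1"
    using indet_inv_indet[of j] by (simp add: algebra_simps)
  finally show ?thesis .
qed

text \<open>
  Pairs of a Laurent polynomial that is congruent to a polynomial in \<open>\<alpha> 0, \<dots>, \<alpha> (n - 1)\<close> and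
  the function of \<open>n\<close> complex variables given by the same polynomial.
\<close>

inductive_set polrel :: "(nat \<Rightarrow> laurent) \<Rightarrow> nat \<Rightarrow> (laurent \<times> ((nat \<Rightarrow> complex) \<Rightarrow> complex)) set"
  for \<alpha> n where
  const: "(const c, \<lambda>_. c) \<in> polrel \<alpha> n"
| var: "i < n \<Longrightarrow> (\<alpha> i, \<lambda>z. z i) \<in> polrel \<alpha> n"
| add: "(p, f) \<in> polrel \<alpha> n \<Longrightarrow> (q, g) \<in> polrel \<alpha> n \<Longrightarrow> (p + q, \<lambda>z. f z + g z) \<in> polrel \<alpha> n"
| mult: "(p, f) \<in> polrel \<alpha> n \<Longrightarrow> (q, g) \<in> polrel \<alpha> n \<Longrightarrow> (p * q, \<lambda>z. f z * g z) \<in> polrel \<alpha> n"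
| kernel: "(p, f) \<in> polrel \<alpha> n \<Longrightarrow> q \<in> GGbar_kernel 3 \<Longrightarrow> (p + q, f) \<in> polrel \<alpha> n"

lemma polrel_zero: "(0, \<lambda>_. 0) \<in> polrel \<alpha> n"
  using polrel.const[of 0] by (simp only: const_0)

lemma polrel_one: "(1, \<lambda>_. 1) \<in> polrel \<alpha> n"
  using polrel.const[of 1] by (simp only: const_1)

lemma polrel_uminus: "(p, f) \<in> polrel \<alpha> n \<Longrightarrow> (- p, \<lambda>z. - f z) \<in> polrel \<alpha> n"
  using polrel.mult[OF polrel.const[of "- 1" \<alpha> n], of p f] by (simp add: const_uminus const_1)

lemma polrel_cong:
  assumes "(p, f) \<in> polrel \<alpha> n" "q - p \<in> GGbar_kernel 3" shows "(q, f) \<in> polrel \<alpha> n"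
proof -
  have "p + (q - p) = q" by simp
  then show ?thesis using polrel.kernel[OF assms] by (simp only:)
qed

lemma polrel_sum:
  "(\<And>x. x \<in> A \<Longrightarrow> (p x, f x) \<in> polrel \<alpha> n) \<Longrightarrow> (sum p A, \<lambda>z. \<Sum>x\<in>A. f x z) \<in> polrel \<alpha> n"
proof (induction A rule: infinite_finite_induct)
  case (insert x A)
  then show ?case by (simp add: polrel.add)
qed (simp_all add: polrel_zero)

lemma polrel_in:
  assumes "(p, f) \<in> polrel \<alpha> n" "\<And>i. \<alpha> i \<in> laurent_in (tuples 3) (frozen 3)"
  shows "p \<in> laurent_in (tuples 3) (frozen 3)"
  using assms(1) by (induction rule: polrel.induct)
    (simp_all add: laurent_in_const laurent_in_add laurent_in_mult assms(2) GGbar_kernel_in)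

lemma polrel_local:
  assumes "(p, f) \<in> polrel \<alpha> n" "\<And>i. i < n \<Longrightarrow> z i = z' i" shows "f z = f z'"
  using assms(1) by (induction rule: polrel.induct) (simp_all only: assms(2))

text \<open>A polynomial in n + 1 variables is regarded as univariate in the last one, on both sides
  of the pair at once: \<open>q\<close> has Laurent coefficients, \<open>g z\<close> complex ones,
  and corresponding coefficients are related in n variables. Congruences are absorbed by the
  difference between \<open>p\<close> and the value of \<open>q\<close>.\<close>

lemma polrel_step:
  assumes "(p, f) \<in> polrel \<alpha> (Suc n)" and \<alpha>: "\<And>i. \<alpha> i \<in> laurent_in (tuples 3) (frozen 3)"
  shows "\<exists>q g. (\<forall>i. (coeff q i, \<lambda>z. coeff (g z) i) \<in> polrel \<alpha> n) \<and>
    p - poly q (\<alpha> n) \<in> GGbar_kernel 3 \<and> (\<forall>z. f z = poly (g z) (z n))"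
  using assms(1)
proof (induction rule: polrel.induct)
  case (const c)
  have "(coeff [:const c:] i, \<lambda>z. coeff [:c:] i) \<in> polrel \<alpha> n" for i
    by (cases i) (simp_all add: polrel.const polrel_zero)
  then show ?case
    by (intro exI[of _ "[:const c:]"] exI[of _ "\<lambda>_. [:c:]"]) (simp add: kernel3_zero)
next
  case (var i)
  show ?case
  proof (cases "i = n")
    case True
    have "(coeff [:0, 1:] j, \<lambda>z. coeff [:0, 1:] j) \<in> polrel \<alpha> n" for j
      by (cases j; cases "j - 1") (simp_all add: polrel_zero polrel_one)
    then show ?thesis
      using True by (intro exI[of _ "[:0, 1:]"] exI[of _ "\<lambda>_. [:0, 1:]"]) (simp add: kernel3_zero)
  next
    case False
    have "(coeff [:\<alpha> i:] j, \<lambda>z. coeff [:z i:] j) \<in> polrel \<alpha> n" for j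
      using var False by (cases j) (simp_all add: polrel.var polrel_zero)
    then show ?thesis
      by (intro exI[of _ "[:\<alpha> i:]"] exI[of _ "\<lambda>z. [:z i:]"]) (simp add: kernel3_zero)
  qed
next
  case (add p1 f1 p2 f2)
  obtain q1 g1 where 1: "\<And>i. (coeff q1 i, \<lambda>z. coeff (g1 z) i) \<in> polrel \<alpha> n"
    "p1 - poly q1 (\<alpha> n) \<in> GGbar_kernel 3" "\<And>z. f1 z = poly (g1 z) (z n)"
    using add.IH(1) by (elim exE conjE) (rule that, (erule spec | assumption)+)
  obtain q2 g2 where 2: "\<And>i. (coeff q2 i, \<lambda>z. coeff (g2 z) i) \<in> polrel \<alpha> n"
    "p2 - poly q2 (\<alpha> n) \<in> GGbar_kernel 3" "\<And>z. f2 z = poly (g2 z) (z n)"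
    using add.IH(2) by (elim exE conjE) (rule that, (erule spec | assumption)+)
  have "p1 + p2 - poly (q1 + q2) (\<alpha> n) = (p1 - poly q1 (\<alpha> n)) + (p2 - poly q2 (\<alpha> n))"
    by simp
  then have "p1 + p2 - poly (q1 + q2) (\<alpha> n) \<in> GGbar_kernel 3"
    using kernel3_add[OF 1(2) 2(2)] by (simp only:)
  then show ?case
    by (intro exI[of _ "q1 + q2"] exI[of _ "\<lambda>z. g1 z + g2 z"] conjI allI)
      (simp_all only: coeff_add poly_add 1(3) 2(3) polrel.add[OF 1(1) 2(1)])
next
  case (mult p1 f1 p2 f2)
  obtain q1 g1 where 1: "\<And>i. (coeff q1 i, \<lambda>z. coeff (g1 z) i) \<in> polrel \<alpha> n"
    "p1 - poly q1 (\<alpha> n) \<in> GGbar_kernel 3" "\<And>z. f1 z = poly (g1 z) (z n)"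
    using mult.IH(1) by (elim exE conjE) (rule that, (erule spec | assumption)+)
  obtain q2 g2 where 2: "\<And>i. (coeff q2 i, \<lambda>z. coeff (g2 z) i) \<in> polrel \<alpha> n"
    "p2 - poly q2 (\<alpha> n) \<in> GGbar_kernel 3" "\<And>z. f2 z = poly (g2 z) (z n)"
    using mult.IH(2) by (elim exE conjE) (rule that, (erule spec | assumption)+)
  have "p1 - (p1 - poly q1 (\<alpha> n)) \<in> laurent_in (tuples 3) (frozen 3)"
    by (intro laurent_in_diff GGbar_kernel_in[OF 1(2)] polrel_in[OF mult.hyps(1) \<alpha>])
  then have "p1 * p2 - poly q1 (\<alpha> n) * poly q2 (\<alpha> n) \<in> GGbar_kernel 3"
    by (intro kernel3_mult_diff 1(2) 2(2) polrel_in[OF mult.hyps(2) \<alpha>]) simp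
  moreover have "(\<Sum>j\<le>i. coeff q1 j * coeff q2 (i - j), \<lambda>z. \<Sum>j\<le>i. coeff (g1 z) j * coeff (g2 z) (i - j))
      \<in> polrel \<alpha> n" for i
    by (intro polrel_sum polrel.mult 1(1) 2(1))
  ultimately show ?case
    by (intro exI[of _ "q1 * q2"] exI[of _ "\<lambda>z. g1 z * g2 z"] conjI allI)
      (simp_all only: coeff_mult poly_mult 1(3) 2(3))
next
  case (kernel p f k)
  obtain q g where 1: "\<And>i. (coeff q i, \<lambda>z. coeff (g z) i) \<in> polrel \<alpha> n"
    "p - poly q (\<alpha> n) \<in> GGbar_kernel 3" "\<And>z. f z = poly (g z) (z n)"
    using kernel.IH by (elim exE conjE) (rule that, (erule spec | assumption)+)
  have "p + k - poly q (\<alpha> n) = (p - poly q (\<alpha> n)) + k" by simp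
  then have "p + k - poly q (\<alpha> n) \<in> GGbar_kernel 3"
    using kernel3_add[OF 1(2) kernel.hyps(2)] by (simp only:)
  then show ?case
    by (intro exI[of _ q] exI[of _ g] conjI allI 1)
qed

lemma polrel_0:
  assumes "(p, f) \<in> polrel \<alpha> 0"
  shows "\<exists>c. p - const c \<in> GGbar_kernel 3 \<and> f = (\<lambda>_. c)"
  using assms
proof (induction rule: polrel.induct)
  case (const c)
  show ?case by (intro exI[of _ c]) (simp add: kernel3_zero)
next
  case (var i)
  then show ?case by simp
next
  case (add p f q g)
  then obtain c d where *: "p - const c \<in> GGbar_kernel 3" "f = (\<lambda>_. c)"
    "q - const d \<in> GGbar_kernel 3" "g = (\<lambda>_. d)" by (elim exE conjE) simp
  have "p + q - const (c + d) = (p - const c) + (q - const d)" by (simp add: const_add)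
  then have "p + q - const (c + d) \<in> GGbar_kernel 3"
    using kernel3_add[OF *(1,3)] by (simp only:)
  then show ?case using *(2,4) by (intro exI[of _ "c + d"]) simp
next
  case (mult p f q g)
  then obtain c d where *: "p - const c \<in> GGbar_kernel 3" "f = (\<lambda>_. c)"
    "q - const d \<in> GGbar_kernel 3" "g = (\<lambda>_. d)" by (elim exE conjE) simp
  have "q - const d + const d \<in> laurent_in (tuples 3) (frozen 3)"
    by (intro laurent_in_add laurent_in_const GGbar_kernel_in *(3))
  then have "p * q - const c * const d \<in> GGbar_kernel 3"
    by (intro kernel3_mult_diff *(1,3) laurent_in_const) simp
  then show ?case using *(2,4) by (intro exI[of _ "c * d"]) (simp add: const_mult)
next
  case (kernel p f k)
  then obtain c where *: "p - const c \<in> GGbar_kernel 3" "f = (\<lambda>_. c)" by (elim exE conjE) simp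
  have "p + k - const c = (p - const c) + k" by simp
  then have "p + k - const c \<in> GGbar_kernel 3"
    using kernel3_add[OF *(1) kernel.hyps(2)] by (simp only:)
  then show ?case using *(2) by (intro exI[of _ c]) simp
qed

text \<open>Induction on the number of variables. For fixed earlier variables the function is a
  univariate complex polynomial vanishing everywhere, so its coefficients vanish; the induction
  hypothesis then puts the corresponding Laurent coefficients into the kernel.\<close>

theorem polrel_zero_function:
  assumes "(p, f) \<in> polrel \<alpha> n" "\<And>z. f z = 0" and \<alpha>: "\<And>i. \<alpha> i \<in> laurent_in (tuples 3) (frozen 3)"
  shows "p \<in> GGbar_kernel 3"
  using assms(1,2)
proof (induction n arbitrary: p f)
  case 0
  obtain c where "p - const c \<in> GGbar_kernel 3" "f = (\<lambda>_. c)"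
    using polrel_0[OF 0(1)] by (elim exE conjE) simp
  moreover have "f (\<lambda>_. 0) = 0" by (rule 0(2))
  ultimately show ?case by (simp add: const_0)
next
  case (Suc n)
  obtain q g where q: "\<And>i. (coeff q i, \<lambda>z. coeff (g z) i) \<in> polrel \<alpha> n"
    "p - poly q (\<alpha> n) \<in> GGbar_kernel 3" "\<And>z. f z = poly (g z) (z n)"
    using polrel_step[OF Suc.prems(1) \<alpha>] by (elim exE conjE) (rule that, (erule spec | assumption)+)
  have "g z = 0" for z
  proof -
    \<comment> \<open>The coefficients depend on the earlier variables only, so the last one can be
      varied while \<open>g z\<close> stays the same polynomial.\<close>
    have "g (z(n := x)) = g z" for x
      by (rule poly_eqI) (rule polrel_local[OF q(1)], simp)
    then have "poly (g z) x = 0" for x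
      using q(3)[of "z(n := x)"] Suc.prems(2)[of "z(n := x)"] by simp
    then show ?thesis by (simp flip: poly_all_0_iff_0)
  qed
  then have "coeff q i \<in> GGbar_kernel 3" for i
    by (intro Suc.IH[OF q(1)]) simp
  then have "coeff q i * \<alpha> n ^ i \<in> GGbar_kernel 3" for i
    by (intro kernel3_mult laurent_in_power \<alpha>)
  then have "(\<Sum>i\<in>A. coeff q i * \<alpha> n ^ i) \<in> GGbar_kernel 3" for A
    by (induction A rule: infinite_finite_induct) (simp_all add: kernel3_zero kernel3_add)
  then have "p - poly q (\<alpha> n) + poly q (\<alpha> n) \<in> GGbar_kernel 3"
    by (intro kernel3_add q(2)) (simp only: poly_altdef)
  then show ?case by simp
qed

lemma polrel_line:
  assumes "(p, f) \<in> polrel \<alpha> n"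
  shows "\<exists>P. \<forall>t. f (\<lambda>i. t * z i) = poly P t"
  using assms
proof (induction rule: polrel.induct)
  case (const c)
  show ?case by (intro exI[of _ "[:c:]"]) simp
next
  case (var i)
  show ?case by (intro exI[of _ "[:0, z i:]"]) simp
next
  case (add p f q g)
  then obtain P Q where "\<forall>t. f (\<lambda>i. t * z i) = poly P t" "\<forall>t. g (\<lambda>i. t * z i) = poly Q t"
    by (elim exE)
  then show ?case by (intro exI[of _ "P + Q"]) simp
next
  case (mult p f q g)
  then obtain P Q where "\<forall>t. f (\<lambda>i. t * z i) = poly P t" "\<forall>t. g (\<lambda>i. t * z i) = poly Q t"
    by (elim exE)
  then show ?case by (intro exI[of _ "P * Q"]) simp
qed

text \<open>On the line through the origin and \<open>z\<close> the two functions become univariate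
  polynomials with P * Q = 0. As Q is nonzero at parameter 0, P is zero, and parameter 1 gives the
  claim at \<open>z\<close>.\<close>

lemma polrel_dense:
  assumes f: "(p, f) \<in> polrel \<alpha> n" and g: "(q, g) \<in> polrel \<alpha> n" and "g (\<lambda>_. 0) \<noteq> 0"
    and zero: "\<And>z. g z \<noteq> 0 \<Longrightarrow> f z = 0"
  shows "f z = 0"
proof -
  obtain P where P: "\<And>t. f (\<lambda>i. t * z i) = poly P t"
    using polrel_line[OF f, of z] by (elim exE) simp
  obtain Q where Q: "\<And>t. g (\<lambda>i. t * z i) = poly Q t"
    using polrel_line[OF g, of z] by (elim exE) simp
  have "poly (P * Q) t = 0" for t
    using zero[of "\<lambda>i. t * z i"] by (cases "poly Q t = 0") (simp_all add: P Q)
  then have "P * Q = 0" by (simp only: flip: poly_all_0_iff_0) simp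
  moreover have "Q \<noteq> 0" using Q[of 0] assms(3) by auto
  ultimately have "P = 0" by simp
  then show ?thesis using P[of 1] by simp
qed


section \<open>A zero test\<close>

lemma frozen_3: "frozen 3 = {[i, i + 1, i + 2] | i. True}"
proof -
  have "[i..i + int 3 - 1] = [i, i + 1, i + 2]" for i
    by (simp add: upto_rec1)
  then show ?thesis by (simp add: frozen_def)
qed

lemma tuples_3: "[i, j, k] \<in> tuples 3 \<longleftrightarrow> i < j \<and> j < k"
  by (auto simp: tuples_def)

lemma tuples_upto_3:
  assumes "is \<in> tuples_upto 3 N"
  obtains i j k where "is = [i, j, k]" "1 \<le> i" "i < j" "j < k" "k \<le> int N"
proof -
  obtain i j k where "is": "is = [i, j, k]"
    using assms by (auto simp: tuples_upto_def tuples_def length_Suc_conv eval_nat_numeral)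
  show ?thesis
    using assms that[OF "is"] by (simp add: "is" tuples_upto_def tuples_3)
qed

section \<open>The recursion for Pluecker coordinates and its free coordinates\<close>

lemma alt_frozen_kernel: "alt [i, i + 1, i + 2] - 1 \<in> GGbar_kernel 3"
proof -
  have "alt [i, i + 1, i + 2] = indet [i, i + 1, i + 2]"
    by (rule alt_strict_sorted) simp
  moreover have "[i, i + 1, i + 2] \<in> frozen 3" unfolding frozen_3 by blast
  ultimately show ?thesis using indet_frozen_kernel[of 3] by simp
qed

lemma alt_3_in: "alt [i, j, k] \<in> laurent_in (tuples 3) S"
  by (rule alt_in) simp

text \<open>In the Pluecker relation for (i, j) and four consecutive indices, omitting the first or
  the last of the four leaves a consecutive minor. Replacing these two minors by 1 solves the
  relation for the coordinate with index k + 3.\<close>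

lemma alt_recursion:
  assumes "i < j"
  shows "alt [i, j, k + 3] - (alt [i, j, k] - alt [k, k + 2, k + 3] * alt [i, j, k + 1]
      + alt [k, k + 1, k + 3] * alt [i, j, k + 2]) \<in> GGbar_kernel 3"
proof -
  let ?F = "alt [k, k + 1, k + 2]" and ?F' = "alt [k + 1, k + 2, k + 3]"
  let ?rel = "pluecker_rel 3 [i, j] [k, k + 1, k + 2, k + 3]"
  have "[i, j] \<in> tuples (3 - 1)" "[k, k + 1, k + 2, k + 3] \<in> tuples (3 + 1)"
    using assms by (auto simp: tuples_def)
  then have rel: "?rel \<in> GGbar_kernel 3"
    by (rule pluecker_rel_kernel[of 3, OF zero_less_numeral])
  have "?F' - 1 \<in> GGbar_kernel 3"
    using alt_frozen_kernel[of "k + 1"] by (simp add: add.assoc)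
  then have F': "(?F' - 1) * alt [i, j, k] \<in> GGbar_kernel 3"
    by (rule kernel3_mult) (rule alt_3_in)
  have F: "(?F - 1) * alt [i, j, k + 3] \<in> GGbar_kernel 3"
    by (rule kernel3_mult[OF alt_frozen_kernel]) (rule alt_3_in)
  have "?rel = alt [i, j, k + 1] * alt [k, k + 2, k + 3] - alt [i, j, k] * ?F'
      - alt [i, j, k + 2] * alt [k, k + 1, k + 3] + alt [i, j, k + 3] * ?F"
    by (simp add: pluecker_rel_def eval_nat_numeral)
  then have "alt [i, j, k + 3] - (alt [i, j, k] - alt [k, k + 2, k + 3] * alt [i, j, k + 1]
      + alt [k, k + 1, k + 3] * alt [i, j, k + 2])
    = ?rel + (?F' - 1) * alt [i, j, k] - (?F - 1) * alt [i, j, k + 3]"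
    by (simp add: algebra_simps)
  then show ?thesis
    using kernel3_diff[OF kernel3_add[OF rel F'] F] by (simp only:)
qed

text \<open>
  In \<open>\<complex>\<^sup>3\<close> a sequence with all consecutive minors equal to 1 satisfies
  \<open>v (k + 3) = v k - det (v k, v (k + 2), v (k + 3)) v (k + 1) + det (v k, v (k + 1), v (k + 3)) v (k + 2)\<close>,
  so the coefficients of this recursion are free coordinates.
\<close>

definition coords :: "nat \<Rightarrow> laurent" where
  "coords n = (let k = int (n div 2) in
     if even n then - alt [k, k + 2, k + 3] else alt [k, k + 1, k + 3])"

lemma coords_even: "coords (2 * k) = - alt [int k, int k + 2, int k + 3]"
  and coords_odd: "coords (2 * k + 1) = alt [int k, int k + 1, int k + 3]"
  by (simp_all add: coords_def Let_def)

lemma coords_in: "coords n \<in> laurent_in (tuples 3) (frozen 3)"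
  unfolding coords_def Let_def by (cases "even n") (simp_all add: laurent_in_uminus alt_3_in)

text \<open>The starting vectors are a cyclic, hence even, permutation of the standard basis, so
  their determinant is 1. The numbers \<open>z (2 * k)\<close> and \<open>z (2 * k + 1)\<close>
  stand for the classes of \<open>coords (2 * k)\<close> and
  \<open>coords (2 * k + 1)\<close>.\<close>

fun rec_seq :: "(nat \<Rightarrow> complex) \<Rightarrow> nat \<Rightarrow> complex vec" where
  "rec_seq z 0 = unit_vec 3 2"
| "rec_seq z (Suc 0) = unit_vec 3 0"
| "rec_seq z (Suc (Suc 0)) = unit_vec 3 1"
| "rec_seq z (Suc (Suc (Suc k))) =
     rec_seq z k + z (2 * k) \<cdot>\<^sub>v rec_seq z (Suc k) + z (2 * k + 1) \<cdot>\<^sub>v rec_seq z (Suc (Suc k))"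

lemma rec_seq_carrier: "rec_seq z k \<in> carrier_vec 3"
  by (induction z k rule: rec_seq.induct) simp_all

lemma det3_linear:
  assumes "c \<in> carrier_vec 3" "d \<in> carrier_vec 3" "e \<in> carrier_vec 3"
  shows "det3 a b (c + x \<cdot>\<^sub>v d + y \<cdot>\<^sub>v e) = det3 a b c + x * det3 a b d + y * det3 a b e"
  using assms[THEN carrier_vecD] by (simp add: det3_def algebra_simps)

lemma det3_rec_seq: "det3 a b (rec_seq z (k + 3)) = det3 a b (rec_seq z k)
    + z (2 * k) * det3 a b (rec_seq z (k + 1)) + z (2 * k + 1) * det3 a b (rec_seq z (k + 2))"
proof -
  have "rec_seq z (k + 3) =
      rec_seq z k + z (2 * k) \<cdot>\<^sub>v rec_seq z (k + 1) + z (2 * k + 1) \<cdot>\<^sub>v rec_seq z (k + 2)"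
    by (simp add: numeral_3_eq_3)
  then show ?thesis
    by (simp only: det3_linear[OF rec_seq_carrier rec_seq_carrier rec_seq_carrier])
qed

text \<open>In the recursion the vector that is dropped has coefficient 1 and the other two summands
  repeat a column, so passing to the next minor is a cyclic rotation.\<close>

lemma det3_rec_seq_frozen: "det3 (rec_seq z k) (rec_seq z (k + 1)) (rec_seq z (k + 2)) = 1"
proof (induction k)
  case 0
  show ?case by (simp add: det3_def numeral_2_eq_2)
next
  case (Suc k)
  have "det3 (rec_seq z (k + 1)) (rec_seq z (k + 2)) (rec_seq z (k + 3)) =
      det3 (rec_seq z (k + 1)) (rec_seq z (k + 2)) (rec_seq z k)"
    unfolding det3_rec_seq det3_repeat by simp
  also have "\<dots> = 1"
    unfolding det3_cyclic[of "rec_seq z (k + 1)"] by (rule Suc)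
  moreover have "Suc k = k + 1" "Suc k + 1 = k + 2" "Suc k + 2 = k + 3" by simp_all
  ultimately show ?case by (simp only:)
qed

text \<open>Induction on the sum of the indices, which swaps preserve. On an increasing triple
  \<open>alt_recursion\<close> and the recursion of \<open>rec_seq\<close> lower the largest index
  in parallel, with the same coefficients.\<close>

lemma polrel_alt:
  assumes "i \<le> N" "j \<le> N" "k \<le> N"
  shows "(alt [int i, int j, int k], \<lambda>z. det3 (rec_seq z i) (rec_seq z j) (rec_seq z k))
    \<in> polrel coords (2 * N)"
  using assms
proof (induction "i + j + k" arbitrary: i j k rule: less_induct)
  case less
  let ?s = "i + j + k"
  let ?R = "\<lambda>i j k. (alt [int i, int j, int k], \<lambda>z. det3 (rec_seq z i) (rec_seq z j) (rec_seq z k))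
    \<in> polrel coords (2 * N)"
  show ?case
  proof (rule triple_wlog[where R = ?R and S = "\<lambda>i j k. i + j + k = ?s \<and> i \<le> N \<and> j \<le> N \<and> k \<le> N"])
    fix i j k assume "?R i j k"
    note neg = polrel_uminus[OF this]
    show "?R j i k"
      unfolding alt_swap12[of "int j"] det3_swap12[of "rec_seq _ j"] by (rule neg)
    show "?R i k j"
      unfolding alt_swap23[of _ "int k"] det3_swap23[of _ "rec_seq _ k"] by (rule neg)
  next
    fix i k
    show "?R i i k" unfolding alt_repeat det3_repeat by (rule polrel_zero)
  next
    fix i j k assume ij: "i < j" and jk: "j < k" and s: "i + j + k = ?s \<and> i \<le> N \<and> j \<le> N \<and> k \<le> N"
    show "?R i j k"
    proof (cases "k < 3")
      case True
      \<comment> \<open>The only increasing triple below 3 is frozen: its class is 1 and so is the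
        determinant of the starting vectors.\<close>
      then have ijk: "i = 0" "j = 1" "k = 2" using ij jk by linarith+
      have "(1 + (alt [0, 1, 2] - 1), \<lambda>_. 1) \<in> polrel coords (2 * N)"
        using polrel.kernel[OF polrel_one alt_frozen_kernel[of 0]] by simp
      moreover have "det3 (rec_seq z 0) (rec_seq z 1) (rec_seq z 2) = 1" for z
        using det3_rec_seq_frozen[of z 0] by (simp only: add_0)
      ultimately show ?thesis unfolding ijk by simp
    next
      case False
      define l where "l = k - 3"
      have k: "k = l + 3" using False by (simp add: l_def)
      have IH: "?R i j l" "?R i j (l + 1)" "?R i j (l + 2)"
        using s k by (intro less.hyps; simp)+
      have even: "(coords (2 * l), \<lambda>z. z (2 * l)) \<in> polrel coords (2 * N)"
        and odd: "(coords (2 * l + 1), \<lambda>z. z (2 * l + 1)) \<in> polrel coords (2 * N)"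
        using s k by (auto intro: polrel.var)
      have pair: "(alt [int i, int j, int l] + coords (2 * l) * alt [int i, int j, int (l + 1)]
          + coords (2 * l + 1) * alt [int i, int j, int (l + 2)],
          \<lambda>z. det3 (rec_seq z i) (rec_seq z j) (rec_seq z k)) \<in> polrel coords (2 * N)"
        unfolding k det3_rec_seq by (intro polrel.add polrel.mult IH even odd)
      have eq: "alt [int i, int j, int l] + coords (2 * l) * alt [int i, int j, int (l + 1)]
          + coords (2 * l + 1) * alt [int i, int j, int (l + 2)] =
          alt [int i, int j, int l] - alt [int l, int l + 2, int l + 3] * alt [int i, int j, int l + 1]
          + alt [int l, int l + 1, int l + 3] * alt [int i, int j, int l + 2]"
        by (simp add: coords_even coords_odd[simplified] add.commute)
      have "alt [int i, int j, int l + 3] - (alt [int i, int j, int l]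
          - alt [int l, int l + 2, int l + 3] * alt [int i, int j, int l + 1]
          + alt [int l, int l + 1, int l + 3] * alt [int i, int j, int l + 2]) \<in> GGbar_kernel 3"
        using ij by (intro alt_recursion) simp
      from polrel_cong[OF pair[unfolded eq] this]
      show ?thesis unfolding k of_nat_add of_nat_numeral .
    qed
  next
    show "?s = ?s \<and> i \<le> N \<and> j \<le> N \<and> k \<le> N" using less.prems by simp
  qed (simp add: add_ac)
qed

lemma frozen_tuples_upto:
  assumes "is \<in> frozen 3 \<inter> tuples_upto 3 N"
  obtains i where "is = [i, i + 1, i + 2]" "1 \<le> i" "i + 2 \<le> int N"
proof -
  obtain i where "is": "is = [i, i + 1, i + 2]" using assms by (auto simp: frozen_3)
  show ?thesis using assms that[OF "is"] by (simp add: "is" tuples_upto_def)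
qed

text \<open>The indeterminates are covered by \<open>polrel_alt\<close>. The inverted ones are
  frozen, so their inverses are congruent to 1 and also evaluate to 1 along
  \<open>rec_seq\<close>.\<close>

lemma polrel_eval:
  assumes "p \<in> local_laurent 3 N"
  shows "(p, \<lambda>z. eval_pdet 3 p (\<lambda>k. rec_seq z (nat k))) \<in> polrel coords (2 * N)"
proof -
  let ?e = "\<lambda>p z. eval_pdet 3 p (\<lambda>k. rec_seq z (nat k))"
  have frozen: "pdet 3 (\<lambda>k. rec_seq z (nat k)) is = 1"
    if "is": "is \<in> frozen 3 \<inter> tuples_upto 3 N" for "is" z
  proof -
    obtain i where "is = [i, i + 1, i + 2]" "1 \<le> i" using "is" by (rule frozen_tuples_upto)
    then show ?thesis
      using det3_rec_seq_frozen[of z "nat i"] by (simp add: pdet_3 nat_add_distrib)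
  qed
  show ?thesis
    using assms unfolding local_laurent_def
  proof (induction rule: laurent_in_induct)
    case (const c)
    show ?case unfolding eval_pdet_const by (rule polrel.const)
  next
    case (indet "is")
    then obtain i j k where *: "is = [i, j, k]" "1 \<le> i" "i < j" "j < k" "k \<le> int N"
      by (rule tuples_upto_3)
    have "indet is = alt [i, j, k]" using * by (simp add: alt_strict_sorted)
    then show ?case
      using polrel_alt[of "nat i" N "nat j" "nat k"] * by (simp add: eval_pdet_alt pdet_3)
  next
    case (inv "is")
    then have "is": "is \<in> frozen 3" "is \<in> frozen 3 \<inter> tuples_upto 3 N" by simp_all
    have "(1 + (inv_indet is - 1), \<lambda>_. 1) \<in> polrel coords (2 * N)"
      by (intro polrel.kernel polrel_one inv_indet_frozen_kernel "is"(1))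
    then show ?case by (simp add: eval_pdet_inv_indet frozen[OF "is"(2)])
  next
    case (add p q)
    from add.IH show ?case unfolding eval_pdet_add by (rule polrel.add)
  next
    case (mult p q)
    have "?e (p * q) z = ?e p z * ?e q z" for z
      using mult.hyps by (rule eval_pdet_mult) (simp add: frozen)
    with polrel.mult[OF mult.IH] show ?case by simp
  qed
qed

section \<open>Cyclic configurations and the zero test on them\<close>

lemma cyc_id: "1 \<le> k \<Longrightarrow> k \<le> int N \<Longrightarrow> cyc N k = k"
  by (simp add: cyc_def)

lemma cyc_add: "cyc N (k + int N) = cyc N k"
proof -
  have "k + int N - 1 = k - 1 + int N" by simp
  then show ?thesis unfolding cyc_def by (simp only: mod_add_self2)
qed

lemma config_3_iff: "v \<in> config 3 N \<longleftrightarrow> v \<in> {1..int N} \<rightarrow>\<^sub>E carrier_vec 3 \<and>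
    (\<forall>s\<in>{1..int N}. det3 (v (cyc N s)) (v (cyc N (s + 1))) (v (cyc N (s + 2))) \<noteq> 0)"
proof -
  have "(\<forall>c\<in>carrier_vec 3. mat_of_cols 3 (map (\<lambda>k. v (cyc N k)) [s..s + int 3 - 1]) *\<^sub>v c = 0\<^sub>v 3
      \<longrightarrow> c = 0\<^sub>v 3) \<longleftrightarrow> det3 (v (cyc N s)) (v (cyc N (s + 1))) (v (cyc N (s + 2))) \<noteq> 0" for s
  proof -
    let ?M = "mat_of_cols 3 [v (cyc N s), v (cyc N (s + 1)), v (cyc N (s + 2))]"
    have "[s..s + int 3 - 1] = [s, s + 1, s + 2]" by (simp add: upto_rec1)
    then have M: "mat_of_cols 3 (map (\<lambda>k. v (cyc N k)) [s..s + int 3 - 1]) = ?M" by simp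
    have "?M \<in> carrier_mat 3 3"
      using mat_of_cols_carrier(1)[of 3 "[v (cyc N s), v (cyc N (s + 1)), v (cyc N (s + 2))]"]
      by (simp add: numeral_3_eq_3)
    from det_0_iff_vec_prod_zero[OF this] show ?thesis
      unfolding M det_mat_of_cols_3 by blast
  qed
  then show ?thesis unfolding config_def by simp
qed

definition normalized :: "nat \<Rightarrow> (int \<Rightarrow> complex vec) \<Rightarrow> bool" where
  "normalized N v \<longleftrightarrow> (\<forall>i. 1 \<le> i \<longrightarrow> i + 2 \<le> int N \<longrightarrow> det3 (v i) (v (i + 1)) (v (i + 2)) = 1)"

text \<open>With all parameters 0 the recursion repeats with period 3. This is the base point at
  which the wrapping minors are seen to be nonzero.\<close>

lemma rec_seq_zero: "rec_seq (\<lambda>_. 0) (3 * n + k) = rec_seq (\<lambda>_. 0) k"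
proof (induction n)
  case (Suc n)
  have step: "rec_seq (\<lambda>_. 0) (Suc (Suc (Suc l))) = rec_seq (\<lambda>_. 0) l" for l
    unfolding rec_seq.simps
    using carrier_vecD[OF rec_seq_carrier[of "\<lambda>_. 0" l]]
      carrier_vecD[OF rec_seq_carrier[of "\<lambda>_. 0" "Suc l"]]
      carrier_vecD[OF rec_seq_carrier[of "\<lambda>_. 0" "Suc (Suc l)"]]
    by (intro eq_vecI) (simp_all del: rec_seq.simps)
  have "3 * Suc n + k = Suc (Suc (Suc (3 * n + k)))" by simp
  then show ?case unfolding Suc[symmetric] by (simp only: step)
qed simp

text \<open>Parameters for which the wrapping minors do not vanish give normalized configurations,
  where the evaluation of \<open>p\<close> is zero by hypothesis. Density extends this to all
  parameters, and a polynomial function that is zero forces \<open>p\<close> into the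
  kernel.\<close>

theorem zero_test:
  assumes N: "3 dvd N" "3 \<le> N" and p: "p \<in> local_laurent 3 N"
    and zero: "\<And>v. v \<in> config 3 N \<Longrightarrow> normalized N v \<Longrightarrow> eval_pdet 3 p v = 0"
  shows "p \<in> GGbar_kernel 3"
proof -
  let ?f = "\<lambda>z. eval_pdet 3 p (\<lambda>k. rec_seq z (nat k))"
  \<comment> \<open>The two minors that wrap around. All others are 1 along \<open>rec_seq\<close>,
    so \<open>config\<close> asks nothing beyond the nonvanishing of this product.\<close>
  let ?g = "\<lambda>z. det3 (rec_seq z (N - 1)) (rec_seq z N) (rec_seq z 1)
    * det3 (rec_seq z N) (rec_seq z 1) (rec_seq z 2)"
  have f: "(p, ?f) \<in> polrel coords (2 * N)" using p by (rule polrel_eval)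
  have g: "(alt [int (N - 1), int N, int 1] * alt [int N, int 1, int 2], ?g) \<in> polrel coords (2 * N)"
    using N by (intro polrel.mult polrel_alt) simp_all
  obtain n where n: "N = 3 * Suc n"
    using N by (elim dvdE) (metis not0_implies_Suc mult_0_right not_numeral_le_zero)
  \<comment> \<open>Because 3 divides N, the wrapping triples at the base point are again cyclic
    rotations of the standard basis.\<close>
  have "N - 1 = 3 * n + 2" "N = 3 * Suc n + 0" using n by simp_all
  then have "rec_seq (\<lambda>_. 0) (N - 1) = unit_vec 3 1" "rec_seq (\<lambda>_. 0) N = unit_vec 3 2"
    unfolding rec_seq_zero by (simp_all only: rec_seq_zero rec_seq.simps numeral_2_eq_2)
  then have g0: "?g (\<lambda>_. 0) \<noteq> 0"
    by (simp add: det3_def numeral_2_eq_2)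
  have "?f z = 0" if "?g z \<noteq> 0" for z
  proof -
    define v where "v = restrict (\<lambda>k. rec_seq z (nat k)) {1..int N}"
    have v: "v k = rec_seq z (nat k)" if "1 \<le> k" "k \<le> int N" for k
      using that by (simp add: v_def)
    have norm: "normalized N v"
      using det3_rec_seq_frozen[of z] by (simp add: normalized_def v nat_add_distrib)
    moreover have "v \<in> config 3 N"
      unfolding config_3_iff
    proof (intro conjI ballI)
      show "v \<in> {1..int N} \<rightarrow>\<^sub>E carrier_vec 3"
        unfolding v_def by (simp add: rec_seq_carrier)
      fix s assume s: "s \<in> {1..int N}"
      have "cyc N (1 + int N) = 1" "cyc N (2 + int N) = 2"
        unfolding cyc_add using N(2) by (intro cyc_id; simp)+
      then have wrap: "cyc N (int N + 1) = 1" "cyc N (int N + 2) = 2"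
        by (simp_all only: add.commute[of "int N"])
      consider "s + 2 \<le> int N" | "s = int N - 1" | "s = int N" using s by force
      then show "det3 (v (cyc N s)) (v (cyc N (s + 1))) (v (cyc N (s + 2))) \<noteq> 0"
      proof cases
        case 1
        then show ?thesis using norm s by (simp add: cyc_id normalized_def)
      next
        case 2
        then have *: "s + 1 = int N" "s + 2 = int N + 1" "nat s = N - 1" by simp_all
        have "v (cyc N s) = rec_seq z (N - 1)"
          using cyc_id[of s N] v[of s] s *(3) by simp
        moreover have "v (cyc N (s + 1)) = rec_seq z N"
          unfolding *(1) using cyc_id[of "int N" N] v[of "int N"] N(2) by simp
        moreover have "v (cyc N (s + 2)) = rec_seq z 1"
          unfolding *(2) wrap using v[of 1] N(2) by simp
        ultimately show ?thesis using that by simp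
      next
        case 3
        then show ?thesis
          using that N(2) s wrap by (simp add: cyc_id v)
      qed
    qed
    ultimately have "eval_pdet 3 p v = 0" by (intro zero)
    moreover have "eval_pdet 3 p v = ?f z"
    proof (rule eval_pdet_cong)
      show "p \<in> laurent_in (tuples_upto 3 N) (frozen 3 \<inter> tuples_upto 3 N)"
        using p by (simp add: local_laurent_def)
    qed (auto simp: tuples_upto_def v)
    ultimately show ?thesis by simp
  qed
  from polrel_dense[OF f g g0 this] have "?f z = 0" for z .
  from polrel_zero_function[OF f this coords_in] show ?thesis .
qed


section \<open>The map \<open>\<kappa>\<close> on sequences of vectors\<close>

definition consec :: "(int \<Rightarrow> complex vec) \<Rightarrow> int \<Rightarrow> complex" where
  "consec u s = det3 (u s) (u (s + 1)) (u (s + 2))"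

definition wvec :: "(int \<Rightarrow> complex vec) \<Rightarrow> int \<Rightarrow> complex vec" where
  "wvec u a = (det3 (u a) (u (a + 2)) (u (a + 3)) / det3 (u (a + 1)) (u (a + 2)) (u (a + 3)))
     \<cdot>\<^sub>v u (a + 1) - u a"

text \<open>\<open>kappa\<close> without a boundary: on sequences indexed by all integers nothing
  wraps, and applied to the periodic extension of a configuration it reproduces
  \<open>kappa\<close>.\<close>

definition tau :: "(int \<Rightarrow> complex vec) \<Rightarrow> int \<Rightarrow> complex vec" where
  "tau u k = (if k mod 3 = 0 then u k else if k mod 3 = 1 then u (k + 1) else wvec u (k - 1))"

lemma mod_3_cases:
  fixes k :: int
  obtains "k mod 3 = 0" | "k mod 3 = 1" | "k mod 3 = 2"
proof -
  have "0 \<le> k mod 3" "k mod 3 < 3" by simp_all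
  then show ?thesis using that by linarith
qed

lemma det3_scale_diff:
  assumes "a \<in> carrier_vec 3" "b \<in> carrier_vec 3"
  shows "det3 (x \<cdot>\<^sub>v a - b) y z = x * det3 a y z - det3 b y z"
  using assms[THEN carrier_vecD] by (simp add: det3_def algebra_simps)

lemma tau_carrier: "(\<And>k. u k \<in> carrier_vec 3) \<Longrightarrow> tau u k \<in> carrier_vec 3"
  by (simp add: tau_def wvec_def)

lemma det3_wvec:
  assumes "\<And>k. u k \<in> carrier_vec 3"
  shows "det3 (wvec u a) y z = det3 (u a) (u (a + 2)) (u (a + 3)) / consec u (a + 1) * det3 (u (a + 1)) y z
    - det3 (u a) y z"
  unfolding wvec_def consec_def by (simp add: det3_scale_diff assms add.assoc)

text \<open>For residues 0 and 1 the triple contains the vector that \<open>wvec\<close> adds with a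
  coefficient, so only the term with -1 survives. For residue 2 a three-term Pluecker relation
  yields the quotient. In particular nonvanishing minors stay nonvanishing, and minors equal to 1
  stay 1.\<close>

lemma consec_tau:
  assumes u: "\<And>k. u k \<in> carrier_vec 3" and nz: "\<And>k. consec u k \<noteq> 0"
  shows "consec (tau u) s = (if s mod 3 = 2 then consec u (s - 1) * consec u (s + 1) / consec u s
    else consec u s)"
proof (cases s rule: mod_3_cases)
  case 1
  then have "(s + 1) mod 3 = 1" "(s + 2) mod 3 = 2" by presburger+
  then have "consec (tau u) s = det3 (u s) (u (s + 2)) (wvec u (s + 1))"
    using 1 by (simp add: consec_def tau_def add_ac)
  also have "\<dots> = det3 (wvec u (s + 1)) (u s) (u (s + 2))"
    by (rule det3_cyclic)
  also have "\<dots> = - det3 (u (s + 1)) (u s) (u (s + 2))"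
    unfolding det3_wvec[OF u] add.assoc one_add_one det3_repeat by simp
  also have "\<dots> = consec u s" by (simp add: consec_def det3_swap12[of "u (s + 1)"])
  finally show ?thesis using 1 by simp
next
  case 2
  then have "(s + 1) mod 3 = 2" "(s + 2) mod 3 = 0" by presburger+
  then have "consec (tau u) s = det3 (u (s + 1)) (wvec u s) (u (s + 2))"
    using 2 by (simp add: consec_def tau_def)
  also have "\<dots> = - det3 (wvec u s) (u (s + 1)) (u (s + 2))"
    by (rule det3_swap12)
  also have "\<dots> = consec u s"
    unfolding det3_wvec[OF u] det3_repeat by (simp add: consec_def)
  finally show ?thesis using 2 by simp
next
  case 3
  define a where "a = s - 1"
  have s: "s = a + 1" by (simp add: a_def)
  have "(s + 1) mod 3 = 0" "(s + 2) mod 3 = 1" using 3 by presburger+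
  then have "consec (tau u) s = det3 (wvec u a) (u (a + 2)) (u (a + 4))"
    using 3 by (simp add: consec_def tau_def s add.assoc)
  also have "\<dots> = consec u a * consec u (a + 2) / consec u (a + 1)"
  proof -
    \<comment> \<open>The vector u (a + 2) belongs to both tuples of the relation, which kills one
      of its four products.\<close>
    have "det3 (u a) (u (a + 2)) (u (a + 3)) * det3 (u (a + 1)) (u (a + 2)) (u (a + 4))
        - det3 (u (a + 1)) (u (a + 2)) (u (a + 3)) * det3 (u a) (u (a + 2)) (u (a + 4))
        = det3 (u a) (u (a + 1)) (u (a + 2)) * det3 (u (a + 2)) (u (a + 3)) (u (a + 4))"
      using det3_pluecker[of "u (a + 2)" "u (a + 4)" "u a" "u (a + 1)" "u (a + 2)" "u (a + 3)"]
        det3_cyclic[of "u (a + 2)" "u (a + 4)" "u a"] det3_cyclic[of "u (a + 2)" "u (a + 4)" "u (a + 1)"]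
        det3_swap23[of "u (a + 2)" "u (a + 4)" "u (a + 3)"]
      by (simp add: det3_repeat algebra_simps)
    then show ?thesis
      unfolding det3_wvec[OF u] using nz[of "a + 1"]
      by (simp add: consec_def add.assoc field_simps)
  qed
  finally show ?thesis using 3 by (simp add: s add.assoc)
qed

lemma consec_tau_nz:
  assumes "\<And>k. u k \<in> carrier_vec 3" "\<And>k. consec u k \<noteq> 0"
  shows "consec (tau u) s \<noteq> 0"
  unfolding consec_tau[OF assms] using assms(2) by simp

section \<open>Comparison of \<open>kappa\<close> on configurations with \<open>tau\<close>\<close>

lemma cyc_range: "1 \<le> N \<Longrightarrow> cyc N k \<in> {1..int N}"
  using pos_mod_bound[of "int N" "k - 1"] pos_mod_sign[of "int N" "k - 1"]
  unfolding cyc_def atLeastAtMost_iff by linarith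

lemma cyc_mod_3: "3 dvd N \<Longrightarrow> cyc N k mod 3 = k mod 3"
proof -
  assume "3 dvd N"
  then have "3 dvd int N" by presburger
  then have "(k - 1) mod int N mod 3 = (k - 1) mod 3" by (rule mod_mod_cancel)
  then show ?thesis unfolding cyc_def by (metis diff_add_cancel mod_add_left_eq)
qed

lemma cyc_cyc_add: "cyc N (cyc N k + l) = cyc N (k + l)"
proof -
  have "cyc N k + l - 1 = (k - 1) mod int N + l" "k + l - 1 = k - 1 + l" by (simp_all add: cyc_def)
  then show ?thesis unfolding cyc_def[of N "_ + l"] by (simp only: mod_add_left_eq)
qed

lemma config_cyc:
  assumes N: "1 \<le> N" and v: "v \<in> config 3 N"
  shows "v (cyc N k) \<in> carrier_vec 3" and "consec (v \<circ> cyc N) k \<noteq> 0"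
proof -
  show "v (cyc N k) \<in> carrier_vec 3"
    using v cyc_range[OF N, of k] unfolding config_3_iff by (auto simp: PiE_iff)
  have "det3 (v (cyc N (cyc N k))) (v (cyc N (cyc N k + 1))) (v (cyc N (cyc N k + 2))) \<noteq> 0"
    using v cyc_range[OF N, of k] unfolding config_3_iff by blast
  then show "consec (v \<circ> cyc N) k \<noteq> 0"
    using cyc_cyc_add[of N k 0] by (simp add: consec_def cyc_cyc_add)
qed

lemma kappa_tau:
  assumes N: "3 dvd N" "3 \<le> N"
  shows "kappa 3 N v (cyc N k) = tau (v \<circ> cyc N) k"
proof -
  let ?k = "cyc N k"
  have k: "1 \<le> ?k" "?k \<le> int N" using cyc_range[of N k] N by auto
  have mod: "?k mod 3 = k mod 3" using N(1) by (rule cyc_mod_3)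
  have N3: "int N mod 3 = 0" using N(1) by presburger
  have c: "cyc N (?k + l) = cyc N (k + l)" for l by (rule cyc_cyc_add)
  have id: "cyc N (?k + l) = ?k + l" if "1 \<le> ?k + l" "?k + l \<le> int N" for l
    using that by (rule cyc_id)
  have kappa: "kappa 3 N v ?k = (if k mod 3 = 1 then v (?k + 1)
      else if k mod 3 = 2 then kappa_vec 3 N v (?k - 1) else v ?k)"
    using k by (simp add: kappa_def mod)
  show ?thesis
  proof (cases k rule: mod_3_cases)
    case 1
    then show ?thesis unfolding kappa by (simp add: tau_def)
  next
    case 2
    \<comment> \<open>\<open>kappa\<close> reads \<open>v (k + 1)\<close> without reducing the
      index. An index that is 1 modulo 3 differs from N, which 3 divides, so its successor is still
      in range.\<close>
    then have "?k \<noteq> int N" using N3 mod by auto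
    then have "v (?k + 1) = v (cyc N (k + 1))" using id[of 1] k c[of 1] by simp
    then show ?thesis using 2 unfolding kappa by (simp add: tau_def)
  next
    case 3
    then have "?k \<noteq> 1" using mod by auto
    then have "cyc N (k - 1) = ?k - 1" using id[of "- 1"] k c[of "- 1"] by simp
    moreover have "cyc N (?k + 1) = cyc N (k + 1)" "cyc N (?k + 2) = cyc N (k + 2)"
      "cyc N ?k = cyc N k" "cyc N (?k - 1) = cyc N (k - 1)"
      using c[of 1] c[of 2] c[of 0] c[of "- 1"] by simp_all
    moreover have "[?k - 1 + 2..?k - 1 + 3] = [?k + 1, ?k + 2]" by (simp add: upto_rec1)
    ultimately show ?thesis
      using 3 unfolding kappa by (simp add: tau_def wvec_def kappa_vec_def Let_def pdet_3 add_ac)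
  qed
qed

lemma kappa_config:
  assumes N: "3 dvd N" "3 \<le> N" and v: "v \<in> config 3 N"
  shows "kappa 3 N v \<in> config 3 N"
proof -
  have N1: "1 \<le> N" using N by simp
  note v' = config_cyc[OF N1 v]
  have u: "(v \<circ> cyc N) k \<in> carrier_vec 3" for k using v'(1) by simp
  have "kappa 3 N v k \<in> carrier_vec 3" if "k \<in> {1..int N}" for k
  proof -
    have "kappa 3 N v k = tau (v \<circ> cyc N) k"
      using kappa_tau[OF N, of v k] cyc_id[of k N] that by simp
    then show ?thesis using tau_carrier[of "v \<circ> cyc N" k, OF u] by simp
  qed
  moreover have "kappa 3 N v \<in> extensional {1..int N}" by (simp add: kappa_def)
  moreover have "det3 (kappa 3 N v (cyc N s)) (kappa 3 N v (cyc N (s + 1))) (kappa 3 N v (cyc N (s + 2))) \<noteq> 0" for s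
    using consec_tau_nz[OF u v'(2), of s] unfolding kappa_tau[OF N] consec_def .
  ultimately show ?thesis unfolding config_3_iff PiE_iff by blast
qed

lemma normalized_consec: "normalized N v \<longleftrightarrow> (\<forall>i. 1 \<le> i \<longrightarrow> i + 2 \<le> int N \<longrightarrow> consec v i = 1)"
  by (simp add: normalized_def consec_def)

lemma kappa_normalized:
  assumes N: "3 dvd N" "3 \<le> N" and v: "v \<in> config 3 N" "normalized N v"
  shows "normalized N (kappa 3 N v)"
  unfolding normalized_consec
proof (intro allI impI)
  fix i assume i: "1 \<le> i" "i + 2 \<le> int N"
  have N1: "1 \<le> N" using N by simp
  note v' = config_cyc[OF N1 v(1)]
  have u: "(v \<circ> cyc N) k \<in> carrier_vec 3" for k using v'(1) by simp
  have one: "consec (v \<circ> cyc N) k = 1" if "1 \<le> k" "k + 2 \<le> int N" for k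
    using v(2) that by (simp add: normalized_consec consec_def cyc_id)
  have "consec (kappa 3 N v) i = consec (tau (v \<circ> cyc N)) i"
    using kappa_tau[OF N, of v i] kappa_tau[OF N, of v "i + 1"] kappa_tau[OF N, of v "i + 2"] i
    by (simp add: consec_def cyc_id)
  also have "\<dots> = 1"
  proof (cases "i mod 3 = 2")
    case True
    \<comment> \<open>The formula for residue 2 involves the minors at i - 1 and i + 1. The residues
      of i and N exclude i = 1 and i + 2 = N, so these two minors do not wrap either.\<close>
    have "int N mod 3 = 0" using N(1) by presburger
    then have "i + 2 \<noteq> int N" using True by presburger
    moreover have "i \<noteq> 1" using True by auto
    ultimately show ?thesis
      unfolding consec_tau[OF u v'(2)] using i one[of i] one[of "i - 1"] one[of "i + 1"] by simp
  next
    case False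
    then show ?thesis
      unfolding consec_tau[OF u v'(2)] using i by (simp add: one)
  qed
  finally show "consec (kappa 3 N v) i = 1" .
qed

text \<open>The first three vectors are repeated to the left and the last three to the right. Each
  new consecutive triple is then a cyclic rotation of one of these two triples, which have
  determinant 1.\<close>

lemma normalized_extend:
  assumes N: "3 dvd N" "3 \<le> N" and v: "normalized N v"
  shows "\<exists>u. (\<forall>k. 1 \<le> k \<longrightarrow> k \<le> int N \<longrightarrow> u k = v k) \<and> (\<forall>s. consec u s = 1)"
proof -
  define u where "u k = v (if k < 1 then cyc 3 k else if k \<le> int N then k else int N - 3 + cyc 3 k)" for k
  have c3: "cyc 3 k = k" if "1 \<le> k" "k \<le> 3" for k using that by (simp add: cyc_def)
  have low: "u k = v (cyc 3 k)" if "k \<le> 3" for k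
    using that N(2) c3[of k] by (simp add: u_def)
  have high: "u k = v (int N - 3 + cyc 3 k)" if "int N - 3 < k" for k
  proof (cases "k \<le> int N")
    case True
    obtain n where n: "int N = 3 * n" using N(1) by (auto elim: dvdE)
    \<comment> \<open>Divisibility of N by 3 aligns the repetition on the right with the last three
      positions themselves.\<close>
    have "cyc 3 k = k - (int N - 3)"
      using True that unfolding cyc_def n by (simp, presburger)
    then show ?thesis using True that N(2) by (simp add: u_def)
  qed (use N(2) in \<open>simp add: u_def\<close>)
  have cyc3: "cyc 3 k = (if k mod 3 = 1 then 1 else if k mod 3 = 2 then 2 else 3)" for k
    unfolding cyc_def by (cases k rule: mod_3_cases) (simp; presburger)+
  have rot: "det3 (v (l + cyc 3 s)) (v (l + cyc 3 (s + 1))) (v (l + cyc 3 (s + 2))) =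
      det3 (v (l + 1)) (v (l + 2)) (v (l + 3))" for l s
  proof (cases s rule: mod_3_cases)
    case 1
    then have "(s + 1) mod 3 = 1" "(s + 2) mod 3 = 2" by presburger+
    then show ?thesis using 1 by (simp add: cyc3 det3_cyclic[of "v (l + 1)"])
  next
    case 2
    then have "(s + 1) mod 3 = 2" "(s + 2) mod 3 = 0" by presburger+
    then show ?thesis using 2 by (simp add: cyc3)
  next
    case 3
    then have "(s + 1) mod 3 = 0" "(s + 2) mod 3 = 1" by presburger+
    then show ?thesis using 3 by (simp add: cyc3 det3_cyclic[of "v (l + 2)"])
  qed
  have one: "det3 (v (l + 1)) (v (l + 2)) (v (l + 3)) = 1" if "0 \<le> l" "l + 3 \<le> int N" for l
    using v[unfolded normalized_def, rule_format, of "l + 1"] that by (simp add: add.assoc)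
  have "consec u s = 1" for s
  proof -
    consider "s + 2 \<le> 3" | "int N - 3 < s" | "1 \<le> s" "s + 2 \<le> int N" by linarith
    then show ?thesis
    proof cases
      case 1
      then show ?thesis
        using rot[of 0 s] one[of 0] N(2) by (simp add: consec_def low)
    next
      case 2
      then show ?thesis
        using rot[of "int N - 3" s] one[of "int N - 3"] N(2) by (simp add: consec_def high)
    next
      case 3
      then show ?thesis
        using v by (simp add: normalized_def consec_def u_def)
    qed
  qed
  moreover have "u k = v k" if "1 \<le> k" "k \<le> int N" for k using that by (simp add: u_def)
  ultimately show ?thesis by (intro exI[of _ u]) simp
qed

lemma local_laurent_subset: "local_laurent m N \<subseteq> laurent_in (tuples m) (frozen m)"
  unfolding local_laurent_def by (rule laurent_in_mono) (auto simp: tuples_upto_def)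

text \<open>\<open>eval_pdet_kernel\<close> asks for minors equal to 1 at all integers, while
  \<open>v\<close> is controlled on 1, ..., N only. The extension of \<open>v\<close> meets the
  stronger condition, and \<open>p - q\<close> sees only the indices on which both agree.\<close>

lemma eval_pdet_well_defined:
  assumes N: "3 dvd N" "3 \<le> N" and v: "normalized N v"
    and p: "p \<in> local_laurent 3 N" and q: "q \<in> local_laurent 3 N" and "p - q \<in> GGbar_kernel 3"
  shows "eval_pdet 3 p v = eval_pdet 3 q v"
proof -
  obtain u where u: "\<forall>k. 1 \<le> k \<longrightarrow> k \<le> int N \<longrightarrow> u k = v k" "\<forall>s. consec u s = 1"
    using normalized_extend[OF N v] by blast
  have "pdet 3 u j = 1" if "j \<in> frozen 3" for j
    using that u(2) by (auto simp: frozen_3 pdet_3 consec_def)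
  then have "eval_pdet 3 (p - q) u = 0" by (rule eval_pdet_kernel[OF assms(6)])
  moreover have "p - q \<in> laurent_in (tuples_upto 3 N) (frozen 3 \<inter> tuples_upto 3 N)"
    using p q unfolding local_laurent_def by (rule laurent_in_diff)
  then have "eval_pdet 3 (p - q) u = eval_pdet 3 (p - q) v"
    by (rule eval_pdet_cong) (auto simp: tuples_upto_def u(1))
  ultimately show ?thesis by (simp add: eval_pdet_diff)
qed


section \<open>The images of the Pluecker coordinates\<close>

text \<open>
  The coefficient of \<open>v a\<close> in the image of \<open>v k\<close>.  The denominator, which is 1 in the quotient,
  makes the formula valid on configurations that are not normalized.
\<close>

definition coef :: "int \<Rightarrow> int \<Rightarrow> int \<Rightarrow> laurent" where
  "coef r k a = (let c = (k - r) mod 3 in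
     if c = 0 then (if a = k then 1 else 0)
     else if c = 1 then (if a = k + 1 then 1 else 0)
     else if a = k then alt [k - 1, k + 1, k + 2] * inv_indet [k, k + 1, k + 2]
     else if a = k - 1 then - 1 else 0)"

definition image_term :: "int \<Rightarrow> int \<times> int \<times> int \<Rightarrow> int \<times> int \<times> int \<Rightarrow> laurent" where
  "image_term r = (\<lambda>(i, j, k) (a, b, c). coef r i a * coef r j b * coef r k c * alt [a, b, c])"

definition nbhd :: "int \<times> int \<times> int \<Rightarrow> (int \<times> int \<times> int) set" where
  "nbhd = (\<lambda>(i, j, k). {i - 1..i + 1} \<times> {j - 1..j + 1} \<times> {k - 1..k + 1})"

text \<open>The trilinear expansion of the determinant on representatives; the box
  \<open>nbhd\<close> contains the supports of all cases of \<open>coef\<close>. The residue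
  \<open>r\<close> marks where the pattern of cases starts: 0 belongs to \<open>t1\<close>, 1 to
  \<open>t2\<close>.\<close>

definition image_poly :: "int \<Rightarrow> int \<times> int \<times> int \<Rightarrow> laurent" where
  "image_poly r x = (\<Sum>y\<in>nbhd x. image_term r x y)"

lemma tuples_upto_sort:
  assumes "distinct [i, j, k]" "{i, j, k} \<subseteq> {1..int N}"
  shows "sort [i, j, k] \<in> tuples_upto 3 N"
proof -
  have "set (sort [i, j, k]) = {i, j, k}" "length (sort [i, j, k]) = 3" "distinct (sort [i, j, k])"
    using assms(1) by (simp_all only: set_sort length_sort distinct_sort) simp_all
  then show ?thesis
    using assms(2) unfolding tuples_upto_def tuples_def by (simp del: sort_key_simps add: strict_sorted_iff)
qed

lemma alt_local:
  assumes "{i, j, k} \<subseteq> {1..int N}" shows "alt [i, j, k] \<in> local_laurent 3 N"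
proof (cases "distinct [i, j, k]")
  case True
  then show ?thesis
    using tuples_upto_sort[OF True assms] unfolding alt_def local_laurent_def
    by (simp only: if_True) (intro laurent_in_mult laurent_in_of_int laurent_in_indet)
next
  case False
  then show ?thesis unfolding alt_def local_laurent_def by (simp only: if_False laurent_in_zero)
qed

lemma inv_indet_frozen_local:
  assumes "1 \<le> k" "k + 2 \<le> int N" shows "inv_indet [k, k + 1, k + 2] \<in> local_laurent 3 N"
proof -
  have "[k, k + 1, k + 2] \<in> frozen 3" by (auto simp: frozen_3)
  moreover have "[k, k + 1, k + 2] \<in> tuples_upto 3 N"
    using assms by (simp add: tuples_upto_def tuples_3)
  ultimately show ?thesis unfolding local_laurent_def by (intro laurent_in_inv_indet) simp_all
qed

text \<open>The bounds keep k - 1 and k + 2 between 1 and N, so that the denominator is one of the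
  inverted minors.\<close>

lemma coef_local:
  assumes "2 \<le> k" "k + 2 \<le> int N" shows "coef r k a \<in> local_laurent 3 N"
proof -
  have "alt [k - 1, k + 1, k + 2] * inv_indet [k, k + 1, k + 2] \<in> local_laurent 3 N"
    using alt_local[of "k - 1" "k + 1" "k + 2" N] inv_indet_frozen_local[of k N] assms
    unfolding local_laurent_def by (intro laurent_in_mult) simp_all
  then show ?thesis
    unfolding coef_def Let_def local_laurent_def
    by (simp add: laurent_in_one laurent_in_zero laurent_in_uminus)
qed

lemma image_term_local:
  assumes "2 \<le> i" "2 \<le> j" "2 \<le> k" "i + 2 \<le> int N" "j + 2 \<le> int N" "k + 2 \<le> int N"
    and y: "y \<in> nbhd (i, j, k)"
  shows "image_term r (i, j, k) y \<in> local_laurent 3 N"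
proof -
  obtain a b c where y': "y = (a, b, c)" by (cases y)
  have "alt [a, b, c] \<in> local_laurent 3 N"
    using y assms(1-6) by (intro alt_local) (simp add: y' nbhd_def)
  then show ?thesis
    using assms(1-6) coef_local[of i N r a] coef_local[of j N r b] coef_local[of k N r c]
    unfolding y' image_term_def local_laurent_def prod.case by (intro laurent_in_mult) simp_all
qed

lemma image_poly_local:
  assumes "2 \<le> i" "2 \<le> j" "2 \<le> k" "i + 2 \<le> int N" "j + 2 \<le> int N" "k + 2 \<le> int N"
  shows "image_poly r (i, j, k) \<in> local_laurent 3 N"
  using image_term_local[OF assms] unfolding image_poly_def local_laurent_def
  by (intro laurent_in_sum)

definition coef_at :: "(int \<Rightarrow> complex vec) \<Rightarrow> int \<Rightarrow> int \<Rightarrow> complex" where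
  "coef_at u k a = (if k mod 3 = 0 then (if a = k then 1 else 0)
     else if k mod 3 = 1 then (if a = k + 1 then 1 else 0)
     else if a = k then det3 (u (k - 1)) (u (k + 1)) (u (k + 2)) / consec u k
     else if a = k - 1 then - 1 else 0)"

lemma sum_nbhd: "(\<Sum>a\<in>{k - 1..k + 1}. f a) = f (k - 1) + f k + f (k + 1)" for k :: int
proof -
  have "{k - 1..k + 1} = {k - 1, k, k + 1}" by auto
  then show ?thesis by (simp add: add.assoc)
qed

lemma det3_tau:
  assumes "\<And>k. u k \<in> carrier_vec 3"
  shows "det3 (tau u k) y z = (\<Sum>a\<in>{k - 1..k + 1}. coef_at u k a * det3 (u a) y z)"
proof (cases k rule: mod_3_cases)
  case 3
  then have "tau u k = wvec u (k - 1)" by (simp add: tau_def)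
  then show ?thesis
    using 3 unfolding sum_nbhd by (simp add: det3_wvec[OF assms] coef_at_def add_ac)
qed (simp_all only: tau_def sum_nbhd coef_at_def, simp_all)

text \<open>Cyclic symmetry of the determinant carries the expansion in the first column over to the
  other two.\<close>

lemma det3_tau_tau_tau:
  assumes u: "\<And>k. u k \<in> carrier_vec 3"
  shows "det3 (tau u i) (tau u j) (tau u k) = (\<Sum>(a, b, c)\<in>nbhd (i, j, k).
    coef_at u i a * coef_at u j b * coef_at u k c * det3 (u a) (u b) (u c))"
proof -
  have cyc: "det3 x (tau u j) z = (\<Sum>b\<in>{j - 1..j + 1}. coef_at u j b * det3 x (u b) z)"
    for x z j
    using det3_tau[of u j z x, OF u] by (simp add: det3_cyclic[of _ z x])
  have cyc': "det3 x y (tau u k) = (\<Sum>c\<in>{k - 1..k + 1}. coef_at u k c * det3 x y (u c))" for x y k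
    using det3_tau[of u k x y, OF u] by (simp add: det3_cyclic)
  show ?thesis
    unfolding det3_tau[of u i, OF u] unfolding cyc unfolding cyc'
    unfolding nbhd_def prod.case
    by (simp add: sum.cartesian_product[symmetric] sum_distrib_left mult.assoc)
qed

lemma eval_local_mult:
  assumes "v \<in> config 3 N" "1 \<le> N" "p \<in> local_laurent 3 N" "q \<in> local_laurent 3 N"
  shows "eval_pdet 3 (p * q) v = eval_pdet 3 p v * eval_pdet 3 q v"
proof (rule eval_pdet_mult[OF assms(3,4)[unfolded local_laurent_def]])
  fix "is" assume "is \<in> frozen 3 \<inter> tuples_upto 3 N"
  then obtain i where i: "is = [i, i + 1, i + 2]" "1 \<le> i" "i + 2 \<le> int N"
    by (rule frozen_tuples_upto)
  then show "pdet 3 v is \<noteq> 0"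
    using config_cyc(2)[OF assms(2,1), of i] by (simp add: pdet_3 consec_def cyc_id)
qed

lemma eval_coef:
  assumes v: "v \<in> config 3 N" and N: "1 \<le> N" and k: "2 \<le> k" "k + 2 \<le> int N"
  shows "eval_pdet 3 (coef 0 k a) v = coef_at (v \<circ> cyc N) k a"
proof (cases "k mod 3 = 2 \<and> a = k")
  case True
  have "eval_pdet 3 (alt [k - 1, k + 1, k + 2] * inv_indet [k, k + 1, k + 2]) v =
      pdet 3 v [k - 1, k + 1, k + 2] * inverse (pdet 3 v [k, k + 1, k + 2])"
    using k eval_local_mult[OF v N alt_local[of "k - 1" "k + 1" "k + 2" N] inv_indet_frozen_local[of k N]]
    by (simp add: eval_pdet_alt eval_pdet_inv_indet)
  then show ?thesis
    using True k by (simp add: coef_def coef_at_def pdet_3 consec_def cyc_id divide_inverse)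
next
  case False
  then show ?thesis
    by (simp add: coef_def coef_at_def eval_pdet_uminus eval_pdet_one eval_pdet_zero)
qed

text \<open>Since \<open>coef\<close> retains the denominators of \<open>kappa\<close>, the identity
  holds at every configuration, normalized or not; admissibility of a lift needs this. The margins
  at both ends prevent wrapping.\<close>

lemma eval_image_poly:
  assumes N: "3 dvd N" "3 \<le> N" and v: "v \<in> config 3 N"
    and ijk: "2 \<le> i" "2 \<le> j" "2 \<le> k" "i + 2 \<le> int N" "j + 2 \<le> int N" "k + 2 \<le> int N"
  shows "eval_pdet 3 (image_poly 0 (i, j, k)) v = pdet 3 (kappa 3 N v) [i, j, k]"
proof -
  have N1: "1 \<le> N" using N by simp
  let ?u = "v \<circ> cyc N"
  have u: "?u k \<in> carrier_vec 3" for k using config_cyc(1)[OF N1 v] by simp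
  have kap: "kappa 3 N v l = tau ?u l" if "2 \<le> l" "l + 2 \<le> int N" for l
    using kappa_tau[OF N, of v l] cyc_id[of l N] that by simp
  have "eval_pdet 3 (image_term 0 (i, j, k) (a, b, c)) v =
      coef_at ?u i a * coef_at ?u j b * coef_at ?u k c * det3 (?u a) (?u b) (?u c)"
    if "(a, b, c) \<in> nbhd (i, j, k)" for a b c
  proof -
    have abc: "{a, b, c} \<subseteq> {1..int N}" using that ijk by (simp add: nbhd_def)
    note C = coef_local[OF ijk(1,4), of 0 a] coef_local[OF ijk(2,5), of 0 b] coef_local[OF ijk(3,6), of 0 c]
    note C' = C[unfolded local_laurent_def]
    have CC: "coef 0 i a * coef 0 j b \<in> local_laurent 3 N"
      "coef 0 i a * coef 0 j b * coef 0 k c \<in> local_laurent 3 N"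
      unfolding local_laurent_def by (intro laurent_in_mult C')+
    have "eval_pdet 3 (image_term 0 (i, j, k) (a, b, c)) v = eval_pdet 3 (coef 0 i a) v
        * eval_pdet 3 (coef 0 j b) v * eval_pdet 3 (coef 0 k c) v * eval_pdet 3 (alt [a, b, c]) v"
      unfolding image_term_def prod.case
      by (simp only: eval_local_mult[OF v N1 CC(2) alt_local[OF abc]]
          eval_local_mult[OF v N1 CC(1) C(3)] eval_local_mult[OF v N1 C(1,2)])
    moreover have "eval_pdet 3 (alt [a, b, c]) v = det3 (?u a) (?u b) (?u c)"
      using abc by (simp add: eval_pdet_alt pdet_3 cyc_id)
    ultimately show ?thesis
      by (simp only: eval_coef[OF v N1 ijk(1,4)] eval_coef[OF v N1 ijk(2,5)] eval_coef[OF v N1 ijk(3,6)])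
  qed
  then have "eval_pdet 3 (image_poly 0 (i, j, k)) v = (\<Sum>(a, b, c)\<in>nbhd (i, j, k).
      coef_at ?u i a * coef_at ?u j b * coef_at ?u k c * det3 (?u a) (?u b) (?u c))"
    unfolding image_poly_def eval_pdet_sum by (intro sum.cong) auto
  also have "\<dots> = pdet 3 (kappa 3 N v) [i, j, k]"
    unfolding det3_tau_tau_tau[OF u, symmetric] pdet_3 using ijk by (simp add: kap comp_def)
  finally show ?thesis .
qed


section \<open>The map \<open>\<sigma>\<^sub>1\<close>\<close>

lemma GGbar_class_eq_iff_3:
  "p \<in> laurent_in (tuples 3) (frozen 3) \<Longrightarrow> q \<in> laurent_in (tuples 3) (frozen 3) \<Longrightarrow>
    GGbar_class 3 p = GGbar_class 3 q \<longleftrightarrow> p - q \<in> GGbar_kernel 3"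
  by (rule GGbar_class_eq_iff) simp_all

text \<open>If two Laurent polynomials give the same function, their difference passes
  \<open>zero_test\<close>; hence the description in \<open>proj\<close> denotes.\<close>

lemma proj_as_function:
  assumes N: "3 dvd N" "3 \<le> N" and p: "p \<in> local_laurent 3 N"
  shows "proj 3 N (as_function 3 N p) = GGbar_class 3 p"
  unfolding proj_def
proof (rule the_equality)
  show "\<exists>q\<in>local_laurent 3 N. as_function 3 N p = as_function 3 N q \<and> GGbar_class 3 p = GGbar_class 3 q"
    using p by blast
  fix y assume "\<exists>q\<in>local_laurent 3 N. as_function 3 N p = as_function 3 N q \<and> y = GGbar_class 3 q"
  then obtain q where q: "q \<in> local_laurent 3 N" "as_function 3 N p = as_function 3 N q"
    "y = GGbar_class 3 q" by blast
  have "eval_pdet 3 (q - p) v = 0" if "v \<in> config 3 N" for v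
    using fun_cong[OF q(2), of v] that by (simp add: as_function_def eval_pdet_diff)
  moreover have "q - p \<in> local_laurent 3 N"
    using p q(1) unfolding local_laurent_def by (intro laurent_in_diff)
  ultimately have "q - p \<in> GGbar_kernel 3" using N by (intro zero_test)
  moreover have "p \<in> laurent_in (tuples 3) (frozen 3)" "q \<in> laurent_in (tuples 3) (frozen 3)"
    using p q(1) local_laurent_subset by blast+
  ultimately show "y = GGbar_class 3 p" unfolding q(3) by (simp only: GGbar_class_eq_iff_3)
qed

text \<open>A representative of an arbitrary lift is congruent to \<open>alt [i, j, k]\<close>, so
  both agree at \<open>kappa 3 N v\<close> when \<open>v\<close> is normalized. Thus
  \<open>sigma_tilde 3 N f\<close> and the image polynomial agree at normalized configurations, and
  \<open>zero_test\<close> turns this into a congruence.\<close>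

lemma proj_sigma_tilde:
  assumes N: "3 dvd N" "3 \<le> N" and ijk: "2 \<le> i" "i < j" "j < k" "k + 2 \<le> int N"
    and f: "f \<in> lifts 3 N (Plu 3 [i, j, k])"
  shows "proj 3 N (sigma_tilde 3 N f) = GGbar_class 3 (image_poly 0 (i, j, k))"
proof -
  let ?a = "alt [i, j, k]" and ?h = "image_poly 0 (i, j, k)"
  obtain p where p: "p \<in> local_laurent 3 N" "f = as_function 3 N p"
    using f by (auto simp: lifts_def local_coord_ring_def)
  obtain q where q: "q \<in> local_laurent 3 N" "sigma_tilde 3 N f = as_function 3 N q"
    using f by (auto simp: lifts_def local_coord_ring_def)
  have a: "?a \<in> local_laurent 3 N" using ijk by (intro alt_local) simp
  have h: "?h \<in> local_laurent 3 N" using ijk by (intro image_poly_local) simp_all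
  have sub: "x \<in> laurent_in (tuples 3) (frozen 3)" if "x \<in> local_laurent 3 N" for x
    using local_laurent_subset that by (rule subsetD)
  have "GGbar_class 3 p = GGbar_class 3 ?a"
    using f proj_as_function[OF N p(1)] by (simp add: lifts_def p(2) Plu_def)
  then have pa: "p - ?a \<in> GGbar_kernel 3"
    by (simp only: GGbar_class_eq_iff_3 sub[OF p(1)] sub[OF a])
  have "eval_pdet 3 (q - ?h) v = 0" if v: "v \<in> config 3 N" "normalized N v" for v
  proof -
    note kv = kappa_config[OF N v(1)] kappa_normalized[OF N v]
    have "eval_pdet 3 q v = sigma_tilde 3 N f v" using v by (simp add: q(2) as_function_def)
    also have "\<dots> = eval_pdet 3 p (kappa 3 N v)"
      using v kv by (simp add: sigma_tilde_def p(2) as_function_def)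
    also have "\<dots> = eval_pdet 3 ?a (kappa 3 N v)"
      by (rule eval_pdet_well_defined[OF N kv(2) p(1) a pa])
    also have "\<dots> = eval_pdet 3 ?h v"
      unfolding eval_pdet_alt using ijk by (intro eval_image_poly[OF N v(1), symmetric]) simp_all
    finally show ?thesis by (simp add: eval_pdet_diff)
  qed
  moreover have "q - ?h \<in> local_laurent 3 N"
    using q(1) h unfolding local_laurent_def by (rule laurent_in_diff)
  ultimately have "q - ?h \<in> GGbar_kernel 3" using N by (intro zero_test)
  then have "GGbar_class 3 q = GGbar_class 3 ?h"
    by (simp only: GGbar_class_eq_iff_3 sub[OF q(1)] sub[OF h])
  then show ?thesis unfolding q(2) by (simp only: proj_as_function[OF N q(1)])
qed

text \<open>Shows that the lifts are not vacuous: the image of the evident lift is given by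
  \<open>image_poly\<close>, whose denominators are frozen minors that do not wrap.\<close>

lemma alt_in_lifts:
  assumes N: "3 dvd N" "3 \<le> N" and ijk: "2 \<le> i" "i < j" "j < k" "k + 2 \<le> int N"
  shows "as_function 3 N (alt [i, j, k]) \<in> lifts 3 N (Plu 3 [i, j, k])"
proof -
  let ?a = "alt [i, j, k]" and ?h = "image_poly 0 (i, j, k)"
  have a: "?a \<in> local_laurent 3 N" using ijk by (intro alt_local) simp
  have h: "?h \<in> local_laurent 3 N" using ijk by (intro image_poly_local) simp_all
  have "sigma_tilde 3 N (as_function 3 N ?a) = as_function 3 N ?h"
  proof
    fix v
    show "sigma_tilde 3 N (as_function 3 N ?a) v = as_function 3 N ?h v"
    proof (cases "v \<in> config 3 N")
      case True
      have "eval_pdet 3 ?h v = pdet 3 (kappa 3 N v) [i, j, k]"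
        using ijk by (intro eval_image_poly[OF N True]) simp_all
      then show ?thesis
        using True kappa_config[OF N True] by (simp add: sigma_tilde_def as_function_def eval_pdet_alt)
    qed (simp add: sigma_tilde_def as_function_def)
  qed
  then show ?thesis
    using a h proj_as_function[OF N a] by (simp add: lifts_def local_coord_ring_def Plu_def)
qed

theorem sigma1_plus_Plu:
  assumes ijk: "2 \<le> i" "i < j" "j < k"
  shows "sigma1_plus 3 (Plu 3 [i, j, k]) = GGbar_class 3 (image_poly 0 (i, j, k))"
  unfolding sigma1_plus_def
proof (rule the_equality)
  let ?x = "Plu 3 [i, j, k]" and ?y = "GGbar_class 3 (image_poly 0 (i, j, k))"
  have large: "lifts 3 N ?x \<noteq> {} \<and> (\<forall>f\<in>lifts 3 N ?x. proj 3 N (sigma_tilde 3 N f) = ?y)"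
    if N: "nat (k + 2) \<le> N" "3 dvd N" for N
  proof -
    have *: "3 \<le> N" "k + 2 \<le> int N" using N(1) ijk by linarith+
    show ?thesis
      using proj_sigma_tilde[OF N(2) *(1) ijk *(2)] alt_in_lifts[OF N(2) *(1) ijk *(2)] by blast
  qed
  then show "\<exists>N0. \<forall>N\<ge>N0. 3 dvd N \<longrightarrow>
      lifts 3 N ?x \<noteq> {} \<and> (\<forall>f\<in>lifts 3 N ?x. proj 3 N (sigma_tilde 3 N f) = ?y)"
    by blast
  fix y assume "\<exists>N0. \<forall>N\<ge>N0. 3 dvd N \<longrightarrow>
      lifts 3 N ?x \<noteq> {} \<and> (\<forall>f\<in>lifts 3 N ?x. proj 3 N (sigma_tilde 3 N f) = y)"
  then obtain N0 where N0: "\<forall>N\<ge>N0. 3 dvd N \<longrightarrow>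
      lifts 3 N ?x \<noteq> {} \<and> (\<forall>f\<in>lifts 3 N ?x. proj 3 N (sigma_tilde 3 N f) = y)"
    by (rule exE)
  \<comment> \<open>A multiple of 3 beyond both thresholds, so that the two candidate values are
    read off from one lift.\<close>
  define N where "N = 3 * (N0 + nat (k + 2))"
  have N: "N0 \<le> N" "3 dvd N" "nat (k + 2) \<le> N" by (simp_all add: N_def)
  note y = large[OF N(3,2)] N0[rule_format, OF N(1,2)]
  obtain f where f: "f \<in> lifts 3 N ?x" using y(1) by blast
  show "y = ?y"
    using bspec[OF conjunct2[OF y(1)] f] bspec[OF conjunct2[OF y(2)] f] by (simp only:)
qed


section \<open>Shifts of classes\<close>

lemma coef_in: "coef r k a \<in> laurent_in (tuples 3) (frozen 3)"
proof -
  have "[k, k + 1, k + 2] \<in> frozen 3" by (auto simp: frozen_3)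
  note inv = inv_indet_frozen_in[OF this]
  show ?thesis
    unfolding coef_def Let_def
    by (simp add: laurent_in_one laurent_in_zero laurent_in_uminus laurent_in_mult alt_3_in inv)
qed

lemma image_poly_in: "image_poly r x \<in> laurent_in (tuples 3) (frozen 3)"
  unfolding image_poly_def image_term_def case_prod_unfold
  by (intro laurent_in_sum laurent_in_mult coef_in alt_3_in)

lemma shift_coef: "shift_laurent t (coef r k a) = coef (r + t) (k + t) (a + t)"
  unfolding coef_def Let_def
  by (simp add: shift_laurent_mult shift_laurent_alt shift_laurent_inv_indet shift_laurent_uminus
      shift_laurent_one shift_laurent_zero algebra_simps)

text \<open>This periodicity makes the shifts by multiples of 3 in \<open>sigma\<close> cancel, and
  identifies the residue -2 that arises for the second map with 1.\<close>

lemma coef_mod: "coef (r + 3 * t) k a = coef r k a"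
proof -
  have "(k - (r + 3 * t)) mod 3 = (k - r) mod 3" by presburger
  then show ?thesis unfolding coef_def by (simp only:)
qed

lemma image_poly_mod: "image_poly (r + 3 * t) x = image_poly r x"
  unfolding image_poly_def image_term_def coef_mod ..

lemma shift_image_poly:
  "shift_laurent t (image_poly r (i, j, k)) = image_poly (r + t) (i + t, j + t, k + t)"
proof -
  have "shift_laurent t (image_term r (i, j, k) (a, b, c)) =
      image_term (r + t) (i + t, j + t, k + t) (a + t, b + t, c + t)" for a b c
    by (simp add: image_term_def shift_laurent_mult shift_coef shift_laurent_alt)
  then show ?thesis
    unfolding image_poly_def shift_laurent_sum
    by (intro sum.reindex_bij_witness[of _ "\<lambda>(a, b, c). (a - t, b - t, c - t)"
          "\<lambda>(a, b, c). (a + t, b + t, c + t)"]) (auto simp: nbhd_def)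
qed

section \<open>The action of \<open>sh\<close> on cosets of cosets\<close>

lemma GGbar_class_eq_image:
  assumes m: "0 < m" and p: "p \<in> laurent_in (tuples m) (frozen m)"
  shows "GGbar_class m p = (\<lambda>q. GG_class m (q + p)) ` GGbar_kernel m"
proof -
  have "GG_class m q \<oplus>\<^bsub>GG m\<^esub> GG_class m p = GG_class m (q + p)" if "q \<in> GGbar_kernel m" for q
    using ring_hom_add[OF GG_class_hom[OF m], of q p] GGbar_kernel_subset[OF m] that p by auto
  then have "(\<lambda>q. GG_class m q \<oplus>\<^bsub>GG m\<^esub> GG_class m p) ` GGbar_kernel m =
      (\<lambda>q. GG_class m (q + p)) ` GGbar_kernel m"
    by (intro image_cong refl)
  moreover have "GGbar_class m p = (\<lambda>q. GG_class m q \<oplus>\<^bsub>GG m\<^esub> GG_class m p) ` GGbar_kernel m"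
    unfolding GGbar_class_def frozen_ideal_eq[OF m] a_r_coset_def' by blast
  ultimately show ?thesis by (simp only:)
qed

lemma shift_tuples: "is \<in> tuples m \<Longrightarrow> map (\<lambda>k. k + t) is \<in> tuples m"
  by (simp add: tuples_def sorted_wrt_map)

lemma shift_frozen: "is \<in> frozen m \<Longrightarrow> map (\<lambda>k. k + t) is \<in> frozen m"
proof -
  assume "is \<in> frozen m"
  then obtain i where i: "is = [i..i + int m - 1]" by (auto simp: frozen_def)
  have "map (\<lambda>k. k + t) [i..i + int m - 1] = [i + t..(i + t) + int m - 1]"
    by (rule nth_equalityI) auto
  then show ?thesis unfolding i frozen_def by blast
qed

lemma shift_carrier:
  "p \<in> laurent_in (tuples m) (frozen m) \<Longrightarrow> shift_laurent t p \<in> laurent_in (tuples m) (frozen m)"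
  by (erule shift_laurent_in) (erule shift_tuples shift_frozen)+

lemma shift_pluecker_rel:
  assumes "length js = m + 1"
  shows "shift_laurent t (pluecker_rel m is js) =
    pluecker_rel m (map (\<lambda>k. k + t) is) (map (\<lambda>k. k + t) js)"
proof -
  have power: "shift_laurent t ((- 1) ^ n) = (- 1) ^ n" for n
    by (induction n) (simp_all add: shift_laurent_one shift_laurent_uminus)
  show ?thesis
    unfolding pluecker_rel_def shift_laurent_sum
    using assms by (intro sum.cong refl) (auto simp: shift_laurent_mult shift_laurent_alt power take_map drop_map nth_map)
qed

lemma shift_pluecker_rels: "p \<in> pluecker_rels m \<Longrightarrow> shift_laurent t p \<in> pluecker_rels m"
proof -
  assume "p \<in> pluecker_rels m"
  then obtain "is" js where p: "p = pluecker_rel m is js" "is \<in> tuples (m - 1)" "js \<in> tuples (m + 1)"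
    by blast
  have "length js = m + 1" using p(3) by (simp add: tuples_def)
  then show ?thesis
    unfolding p(1) using shift_pluecker_rel[of js m t "is"] shift_tuples[OF p(2)] shift_tuples[OF p(3)]
    by blast
qed

text \<open>Preimage of an ideal under a ring endomorphism. Together with minimality it shows that
  an ideal generated by a shift-stable set is shift-stable.\<close>

lemma ideal_shift_vimage:
  assumes "ideal A (laurent_ring m)"
  shows "ideal {p \<in> laurent_in (tuples m) (frozen m). shift_laurent t p \<in> A} (laurent_ring m)"
    (is "ideal ?B _")
proof -
  interpret A: ideal A "laurent_ring m" by (rule assms)
  have z: "0 \<in> A" using additive_subgroup.zero_closed[OF A.is_additive_subgroup] by simp
  have add: "x + y \<in> A" if "x \<in> A" "y \<in> A" for x y using A.a_closed[OF that] by simp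
  have mult: "x * y \<in> A" if "x \<in> A" "y \<in> laurent_in (tuples m) (frozen m)" for x y
    using A.I_r_closed[OF that(1), of y] that(2) by simp
  have neg: "- x \<in> A" if "x \<in> A" for x
    using mult[OF that laurent_in_of_int[of "- 1"]] by simp
  show ?thesis
  proof (rule idealI)
    show "ring (laurent_ring m)" by (rule laurent_ring.ring_axioms)
    show "subgroup ?B (add_monoid (laurent_ring m))"
    proof (intro subgroup.intro)
      fix x assume x: "x \<in> ?B"
      have "inv\<^bsub>add_monoid (laurent_ring m)\<^esub> x = - x"
        using x laurent_ring.minus_equality[of _ "- x" x] by (simp add: a_inv_def laurent_in_uminus)
      then show "inv\<^bsub>add_monoid (laurent_ring m)\<^esub> x \<in> ?B"
        using x by (simp add: laurent_in_uminus shift_laurent_uminus neg)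
    qed (auto simp: laurent_in_zero laurent_in_add shift_laurent_add shift_laurent_zero z add)
  qed (auto simp: mult.commute laurent_in_mult shift_laurent_mult mult shift_carrier)
qed

text \<open>Stability under the inverse shift upgrades the inclusion to an equality.\<close>

lemma shift_laurent_image:
  assumes "\<And>t p. p \<in> A \<Longrightarrow> shift_laurent t p \<in> A"
  shows "shift_laurent t ` A = A"
proof (intro equalityI subsetI)
  fix p assume "p \<in> A"
  then have "shift_laurent (- t) p \<in> A" by (rule assms)
  moreover have "p = shift_laurent t (shift_laurent (- t) p)"
    by (simp add: shift_laurent_shift_laurent shift_laurent_by_zero)
  ultimately show "p \<in> shift_laurent t ` A" by (rule image_eqI[rotated])
qed (auto intro: assms)

lemma shift_pluecker_ideal:
  assumes m: "0 < m" shows "shift_laurent t ` pluecker_ideal m = pluecker_ideal m"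
proof (rule shift_laurent_image)
  fix t p assume p: "p \<in> pluecker_ideal m"
  let ?B = "{p \<in> laurent_in (tuples m) (frozen m). shift_laurent t p \<in> pluecker_ideal m}"
  have self: "pluecker_rels m \<subseteq> pluecker_ideal m"
    unfolding pluecker_ideal_def
    using laurent_ring.genideal_self[of "pluecker_rels m" m] pluecker_rels_in[OF m] by simp
  have "pluecker_rels m \<subseteq> ?B"
  proof
    fix q assume q: "q \<in> pluecker_rels m"
    show "q \<in> ?B"
      using subsetD[OF pluecker_rels_in[OF m] q] subsetD[OF self shift_pluecker_rels[OF q]]
      by (intro CollectI conjI)
  qed
  then have "pluecker_ideal m \<subseteq> ?B"
    using laurent_ring.genideal_minimal[OF ideal_shift_vimage[OF pluecker_ideal[OF m]]]
    unfolding pluecker_ideal_def[of m, symmetric] by (simp only: pluecker_ideal_def)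
  then show "shift_laurent t p \<in> pluecker_ideal m"
    using p by (auto dest: subsetD)
qed

lemma shift_kernel:
  assumes m: "0 < m" shows "shift_laurent t ` GGbar_kernel m = GGbar_kernel m"
proof (rule shift_laurent_image)
  fix t p assume p: "p \<in> GGbar_kernel m"
  let ?B = "{p \<in> laurent_in (tuples m) (frozen m). shift_laurent t p \<in> GGbar_kernel m}"
  have "GGbar_kernel m \<subseteq> ?B"
  proof (rule GGbar_kernel_minimal[OF m ideal_shift_vimage[OF GGbar_kernel_ideal[OF m]]])
    show "pluecker_rels m \<subseteq> ?B"
    proof
      fix q assume q: "q \<in> pluecker_rels m"
      obtain "is" js where "shift_laurent t q = pluecker_rel m is js" "is \<in> tuples (m - 1)" "js \<in> tuples (m + 1)"
        using shift_pluecker_rels[OF q, of t] by blast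
      then have "shift_laurent t q \<in> GGbar_kernel m" using pluecker_rel_kernel[OF m] by (simp only:)
      then show "q \<in> ?B" using subsetD[OF pluecker_rels_in[OF m] q] by (intro CollectI conjI)
    qed
    fix j assume j: "j \<in> frozen m"
    have "shift_laurent t (indet j - 1) = indet (map (\<lambda>k. k + t) j) - 1"
      using shift_laurent_add[of t "indet j" "- 1"]
      by (simp add: shift_laurent_uminus shift_laurent_one shift_laurent_indet)
    then have "shift_laurent t (indet j - 1) \<in> GGbar_kernel m"
      using indet_frozen_kernel[OF m shift_frozen[OF j]] by (simp only:)
    then show "indet j - 1 \<in> ?B"
      by (intro CollectI conjI laurent_in_diff indet_frozen_in j laurent_in_one)
  qed
  then show "shift_laurent t p \<in> GGbar_kernel m"
    using p by (auto dest: subsetD)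
qed

lemma shift_GG_class:
  assumes m: "0 < m" shows "shift_laurent t ` GG_class m p = GG_class m (shift_laurent t p)"
proof -
  have coset: "GG_class m q = (\<lambda>i. i + q) ` pluecker_ideal m" for q
    by (auto simp: GG_class_def a_r_coset_def')
  have "shift_laurent t ` GG_class m p = (\<lambda>i. i + shift_laurent t p) ` shift_laurent t ` pluecker_ideal m"
    unfolding coset image_image shift_laurent_add ..
  then show ?thesis unfolding coset shift_pluecker_ideal[OF m] .
qed

text \<open>The setwise definition of \<open>sh\<close> is compatible with representatives because
  shifts map both the Pluecker ideal and the kernel onto themselves.\<close>

theorem sh_GGbar_class:
  assumes m: "0 < m" and p: "p \<in> laurent_in (tuples m) (frozen m)"
  shows "sh t (GGbar_class m p) = GGbar_class m (shift_laurent t p)"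
proof -
  have "sh t (GGbar_class m p) = (\<lambda>q. GG_class m (q + shift_laurent t p)) ` shift_laurent t ` GGbar_kernel m"
    unfolding GGbar_class_eq_image[OF m p] sh_def image_image shift_GG_class[OF m] shift_laurent_add ..
  then show ?thesis
    unfolding GGbar_class_eq_image[OF m shift_carrier[OF p]] shift_kernel[OF m] .
qed


section \<open>Determinants of formal combinations\<close>

context
  fixes C :: "laurent set" and cls :: "laurent \<Rightarrow> laurent set set"
  defines "C \<equiv> laurent_in (tuples 3) (frozen 3)" and "cls \<equiv> GGbar_class 3"
begin

interpretation h: ring_hom_cring "laurent_ring 3" "GGbar 3" cls
  unfolding cls_def by (rule GGbar_class_hom) simp

lemma cls_closed: "p \<in> C \<Longrightarrow> cls p \<in> carrier (GGbar 3)"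
  using h.hom_closed[of p] by (simp add: C_def)

lemma cls_mult: "p \<in> C \<Longrightarrow> q \<in> C \<Longrightarrow> cls (p * q) = cls p \<otimes>\<^bsub>GGbar 3\<^esub> cls q"
  using h.hom_mult[of p q] by (simp add: C_def)

lemma cls_add: "p \<in> C \<Longrightarrow> q \<in> C \<Longrightarrow> cls (p + q) = cls p \<oplus>\<^bsub>GGbar 3\<^esub> cls q"
  using h.hom_add[of p q] by (simp add: C_def)

lemma cls_diff: "p \<in> C \<Longrightarrow> q \<in> C \<Longrightarrow> cls (p - q) = cls p \<ominus>\<^bsub>GGbar 3\<^esub> cls q"
  using ring_hom_diff[OF h.ring_hom_cring_axioms, of p q] by (simp add: C_def)

lemma cls_zero: "cls 0 = \<zero>\<^bsub>GGbar 3\<^esub>" and cls_one: "cls 1 = \<one>\<^bsub>GGbar 3\<^esub>"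
  using h.hom_zero h.hom_one by simp_all

lemma cls_sum:
  assumes "finite A" "\<And>x. x \<in> A \<Longrightarrow> f x \<in> C"
  shows "cls (sum f A) = finsum (GGbar 3) (\<lambda>x. cls (f x)) A"
  using assms
proof (induction A)
  case empty
  show ?case by (simp only: sum.empty cls_zero h.S.finsum_empty)
next
  case (insert x A)
  have "finsum (GGbar 3) (\<lambda>x. cls (f x)) (insert x A) =
      cls (f x) \<oplus>\<^bsub>GGbar 3\<^esub> finsum (GGbar 3) (\<lambda>x. cls (f x)) A"
    using insert by (intro h.S.finsum_insert) (auto intro: cls_closed)
  moreover have "sum f A \<in> C" using insert.prems unfolding C_def by (intro laurent_in_sum) simp
  moreover have "f x \<in> C" using insert.prems by simp
  ultimately show ?case using insert by (simp add: cls_add)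
qed

text \<open>\<open>triple_det\<close> sums over the supports of the classes, which can be smaller
  than those of the representatives, since a nonzero Laurent polynomial may have class zero. The
  summands gained by passing to the box vanish.\<close>

lemma triple_det_class:
  assumes fin: "finite A" "finite B" "finite D"
    and C: "\<And>a. f a \<in> C" "\<And>a. g a \<in> C" "\<And>a. k a \<in> C"
    and zero: "\<And>a. a \<notin> A \<Longrightarrow> f a = 0" "\<And>a. a \<notin> B \<Longrightarrow> g a = 0" "\<And>a. a \<notin> D \<Longrightarrow> k a = 0"
  shows "triple_det (\<lambda>a. cls (f a)) (\<lambda>a. cls (g a)) (\<lambda>a. cls (k a)) =
    cls (\<Sum>(a, b, c)\<in>A \<times> B \<times> D. f a * g b * k c * alt [a, b, c])"
proof -
  let ?t = "\<lambda>x. f (fst x) * g (fst (snd x)) * k (snd (snd x)) * alt [fst x, fst (snd x), snd (snd x)]"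
  have alt: "alt [a, b, c] \<in> C" for a b c unfolding C_def by (rule alt_3_in)
  have CC: "p * q \<in> C" if "p \<in> C" "q \<in> C" for p q
    using that unfolding C_def by (rule laurent_in_mult)
  have t: "?t x \<in> C" for x by (intro CC C alt)
  let ?s = "comb_supp (\<lambda>a. cls (f a)) \<times> comb_supp (\<lambda>a. cls (g a)) \<times> comb_supp (\<lambda>a. cls (k a))"
  have summand: "(\<lambda>(a, b, c). cls (f a) \<otimes>\<^bsub>GGbar 3\<^esub> cls (g b) \<otimes>\<^bsub>GGbar 3\<^esub> cls (k c) \<otimes>\<^bsub>GGbar 3\<^esub> Plu 3 [a, b, c])
      = (\<lambda>x. cls (?t x))"
    by (simp add: fun_eq_iff Plu_def cls_mult CC C alt flip: cls_def)
  have supp: "comb_supp (\<lambda>a. cls (q a)) \<subseteq> Q" if "\<And>a. a \<notin> Q \<Longrightarrow> q a = 0" for q Q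
  proof (rule subsetI, rule ccontr)
    fix a assume "a \<in> comb_supp (\<lambda>a. cls (q a))" "a \<notin> Q"
    then show False using that[of a] cls_zero by (simp add: comb_supp_def)
  qed
  have sub: "?s \<subseteq> A \<times> B \<times> D"
    by (intro Sigma_mono supp zero)
  have null: "cls (?t x) = \<zero>\<^bsub>GGbar 3\<^esub>" if "x \<in> A \<times> B \<times> D - ?s" for x
  proof -
    have "cls (f (fst x)) = \<zero>\<^bsub>GGbar 3\<^esub> \<or> cls (g (fst (snd x))) = \<zero>\<^bsub>GGbar 3\<^esub> \<or> cls (k (snd (snd x))) = \<zero>\<^bsub>GGbar 3\<^esub>"
      using that by (cases x) (auto simp: comb_supp_def)
    then show ?thesis
      by (elim disjE) (simp_all add: cls_mult CC C alt cls_closed)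
  qed
  have "triple_det (\<lambda>a. cls (f a)) (\<lambda>a. cls (g a)) (\<lambda>a. cls (k a)) = finsum (GGbar 3) (\<lambda>x. cls (?t x)) ?s"
    unfolding triple_det_def summand ..
  also have "\<dots> = finsum (GGbar 3) (\<lambda>x. cls (?t x)) (A \<times> B \<times> D)"
    using fin sub null t by (intro h.S.add.finprod_mono_neutral_cong_left) (auto intro: cls_closed)
  also have "\<dots> = cls (\<Sum>x\<in>A \<times> B \<times> D. ?t x)"
    using fin t by (intro cls_sum[symmetric]) simp_all
  finally show ?thesis by (simp only: case_prod_unfold)
qed

lemma vsym_class: "vsym k = (\<lambda>j. cls (if j = k then 1 else 0))"
  by (simp add: vsym_def fun_eq_iff cls_zero cls_one)

lemma triple_det_vsym: "triple_det (vsym a) (vsym b) (vsym c) = cls (alt [a, b, c])"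
proof -
  have "(if P then 1 else 0) \<in> C" for P
    unfolding C_def by (simp add: laurent_in_one laurent_in_zero)
  then show ?thesis
    unfolding vsym_class by (subst triple_det_class[of "{a}" "{b}" "{c}"]) simp_all
qed

lemma comb_class:
  assumes "p \<in> C"
  shows "comb_diff (comb_scale (cls p) (vsym k)) (vsym l) =
    (\<lambda>j. cls (p * (if j = k then 1 else 0) - (if j = l then 1 else 0)))"
proof
  fix j
  have C: "(if P then 1 else 0) \<in> C" for P
    unfolding C_def by (simp add: laurent_in_one laurent_in_zero)
  have "p * (if j = k then 1 else 0) \<in> C"
    using assms C[of "j = k"] unfolding C_def by (rule laurent_in_mult)
  then show "comb_diff (comb_scale (cls p) (vsym k)) (vsym l) j =
      cls (p * (if j = k then 1 else 0) - (if j = l then 1 else 0))"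
    unfolding comb_diff_def comb_scale_def vsym_class
    by (simp only: cls_diff cls_mult C assms)
qed

lemma coef_class:
  "(\<lambda>a. cls (coef r k a)) = (if (k - r) mod 3 = 0 then vsym k
     else if (k - r) mod 3 = 1 then vsym (k + 1)
     else comb_diff (comb_scale (triple_det (vsym (k - 1)) (vsym (k + 1)) (vsym (k + 2))) (vsym k)) (vsym (k - 1)))"
proof (cases "(k - r) mod 3 = 0 \<or> (k - r) mod 3 = 1")
  case True
  then show ?thesis unfolding coef_def vsym_class Let_def by auto
next
  case False
  let ?p = "alt [k - 1, k + 1, k + 2]" and ?i = "inv_indet [k, k + 1, k + 2]"
  have fr: "[k, k + 1, k + 2] \<in> frozen 3" by (auto simp: frozen_3)
  have p: "?p \<in> C" unfolding C_def by (rule alt_3_in)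
  \<comment> \<open>Here the denominator inherited from \<open>kappa\<close> disappears, as a frozen
    inverse is congruent to 1.\<close>
  have "(?i - 1) * ?p \<in> GGbar_kernel 3"
    using inv_indet_frozen_kernel[OF fr] p unfolding C_def by (rule kernel3_mult)
  moreover have "(?i - 1) * ?p = ?p * ?i - ?p" by (simp add: algebra_simps)
  moreover have "?p * ?i \<in> C"
    using p inv_indet_frozen_in[OF fr] unfolding C_def by (rule laurent_in_mult)
  ultimately have "cls (?p * ?i) = cls ?p"
    using p unfolding cls_def C_def by (simp only: GGbar_class_eq_iff_3)
  then show ?thesis
    unfolding triple_det_vsym comb_class[OF p] using False by (auto simp: coef_def fun_eq_iff)
qed

lemma triple_det_coef:
  "triple_det (\<lambda>a. cls (coef r i a)) (\<lambda>a. cls (coef r j a)) (\<lambda>a. cls (coef r k a)) =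
    cls (image_poly r (i, j, k))"
proof -
  have zero: "coef r l a = 0" if "a \<notin> {l - 1..l + 1}" for l a
    using that by (auto simp: coef_def Let_def)
  show ?thesis
    by (subst triple_det_class[of "{i - 1..i + 1}" "{j - 1..j + 1}" "{k - 1..k + 1}"])
      (simp_all add: zero image_poly_def nbhd_def image_term_def coef_in[folded C_def])
qed

end

lemma triple_det_t1:
  "triple_det (t1 i) (t1 j) (t1 k) = GGbar_class 3 (image_poly 0 (i, j, k))"
proof -
  have "t1 l = (\<lambda>a. GGbar_class 3 (coef 0 l a))" for l
    unfolding coef_class t1_def by simp
  then show ?thesis by (simp only: triple_det_coef)
qed

lemma triple_det_t2:
  "triple_det (t2 i) (t2 j) (t2 k) = GGbar_class 3 (image_poly 1 (i, j, k))"
proof -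
  have "t2 l = (\<lambda>a. GGbar_class 3 (coef 1 l a))" for l
  proof -
    have "(l - 1) mod 3 = 0 \<longleftrightarrow> l mod 3 = 1" "(l - 1) mod 3 = 1 \<longleftrightarrow> l mod 3 = 2" by presburger+
    then show ?thesis
      unfolding coef_class t2_def by (cases l rule: mod_3_cases) simp_all
  qed
  then show ?thesis by (simp only: triple_det_coef)
qed


section \<open>The maps \<open>\<sigma>\<^sub>1\<close> and \<open>\<sigma>\<^sub>2\<close>\<close>

lemma sh_Plu: "sh t (Plu 3 [i, j, k]) = Plu 3 [i + t, j + t, k + t]"
  unfolding Plu_def by (simp add: sh_GGbar_class alt_3_in shift_laurent_alt)

lemma sh_image_poly:
  "sh t (GGbar_class 3 (image_poly r (i, j, k))) = GGbar_class 3 (image_poly (r + t) (i + t, j + t, k + t))"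
  by (simp add: sh_GGbar_class image_poly_in shift_image_poly)

lemma Plu_in_GGbar_plus:
  assumes "1 \<le> i" "i < j" "j < k" shows "Plu 3 [i, j, k] \<in> GGbar_plus 3"
  unfolding GGbar_plus_def
  by (intro generate_ring.incl UnI2 CollectI exI[of _ "[i, j, k]"]) (use assms in \<open>simp add: tuples_3\<close>)

lemma sigma_eqI:
  assumes "\<And>t. T \<le> t \<Longrightarrow> sh (int m * t) x \<in> GGbar_plus m \<and>
    y = sh (- int m * t) (sigma_plus m k (sh (int m * t) x))"
  shows "sigma m k x = y"
  unfolding sigma_def
proof (rule the_equality)
  show "\<exists>T. \<forall>t\<ge>T. sh (int m * t) x \<in> GGbar_plus m \<and>
      y = sh (- int m * t) (sigma_plus m k (sh (int m * t) x))"
    using assms by (intro exI[of _ T] allI impI)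
  fix y' assume "\<exists>T. \<forall>t\<ge>T. sh (int m * t) x \<in> GGbar_plus m \<and>
      y' = sh (- int m * t) (sigma_plus m k (sh (int m * t) x))"
  then obtain T' where T': "\<forall>t\<ge>T'. sh (int m * t) x \<in> GGbar_plus m \<and>
      y' = sh (- int m * t) (sigma_plus m k (sh (int m * t) x))" by (rule exE)
  show "y' = y"
    using T'[rule_format, of "max T T'"] assms[of "max T T'"] by simp
qed

lemma sigma_1_Plu:
  assumes "i < j" "j < k"
  shows "sigma 3 1 (Plu 3 [i, j, k]) = GGbar_class 3 (image_poly 0 (i, j, k))"
proof (rule sigma_eqI)
  \<comment> \<open>The threshold ensures that i + 3 t is at least 2, where
    \<open>sigma1_plus_Plu\<close> applies.\<close>
  fix t assume "\<bar>i\<bar> + 2 \<le> t"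
  then have t: "2 \<le> i + 3 * t" by simp
  have "sigma_plus 3 1 (sh (3 * t) (Plu 3 [i, j, k])) =
      GGbar_class 3 (image_poly 0 (i + 3 * t, j + 3 * t, k + 3 * t))"
    unfolding sigma_plus_def sh_Plu using t assms by (simp add: sigma1_plus_Plu)
  then show "sh (int 3 * t) (Plu 3 [i, j, k]) \<in> GGbar_plus 3 \<and>
      GGbar_class 3 (image_poly 0 (i, j, k)) =
        sh (- int 3 * t) (sigma_plus 3 1 (sh (int 3 * t) (Plu 3 [i, j, k])))"
    using t assms image_poly_mod[of 0 "- t" "(i, j, k)"]
    by (simp add: sh_image_poly) (simp add: sh_Plu Plu_in_GGbar_plus)
qed

text \<open>For m = 3 and k = 2 the conjugating shifts are by 2 and by -2. Shifting
  \<open>image_poly 0\<close> back by 2 moves its residue to -2, which is 1 modulo 3, the start of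
  the pattern of \<open>t2\<close>.\<close>

lemma sigma_2_Plu:
  assumes "i < j" "j < k"
  shows "sigma 3 2 (Plu 3 [i, j, k]) = GGbar_class 3 (image_poly 1 (i, j, k))"
proof (rule sigma_eqI)
  fix t assume "\<bar>i\<bar> + 2 \<le> t"
  then have t: "2 \<le> i + 3 * t" by simp
  have "sh 2 (sh (3 * t) (Plu 3 [i, j, k])) = Plu 3 [i + 3 * t + 2, j + 3 * t + 2, k + 3 * t + 2]"
    by (simp only: sh_Plu)
  then have "sigma1_plus 3 (sh 2 (sh (3 * t) (Plu 3 [i, j, k]))) =
      GGbar_class 3 (image_poly 0 (i + 3 * t + 2, j + 3 * t + 2, k + 3 * t + 2))"
    using t assms by (simp add: sigma1_plus_Plu)
  then have "sigma_plus 3 2 (sh (3 * t) (Plu 3 [i, j, k])) =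
      GGbar_class 3 (image_poly (- 2) (i + 3 * t, j + 3 * t, k + 3 * t))"
    by (simp add: sigma_plus_def sh_image_poly)
  \<comment> \<open>The multiple - 1 - t comes from 1 + 3 (- 1 - t) = - 2 - 3 t.\<close>
  moreover have "image_poly (- 2 + - 3 * t) (i, j, k) = image_poly 1 (i, j, k)"
    using image_poly_mod[of 1 "- 1 - t" "(i, j, k)"] by (simp add: algebra_simps)
  ultimately show "sh (int 3 * t) (Plu 3 [i, j, k]) \<in> GGbar_plus 3 \<and>
      GGbar_class 3 (image_poly 1 (i, j, k)) =
        sh (- int 3 * t) (sigma_plus 3 2 (sh (int 3 * t) (Plu 3 [i, j, k])))"
    using t assms by (simp add: sh_image_poly) (simp add: sh_Plu Plu_in_GGbar_plus)
qed

theorem lemma6p1: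
  fixes i1 i2 i3 :: int
  assumes "i1 < i2" and "i2 < i3"
  shows "sigma 3 1 (Plu 3 [i1, i2, i3]) = triple_det (t1 i1) (t1 i2) (t1 i3)
       \<and> sigma 3 2 (Plu 3 [i1, i2, i3]) = triple_det (t2 i1) (t2 i2) (t2 i3)"
  unfolding triple_det_t1 triple_det_t2 sigma_1_Plu[OF assms] sigma_2_Plu[OF assms] by simp

end
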